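(* Assume there are sequences $\{\delta_n\in(0,1)\}_{n\ge1}$ and $\{p_n\in(0,1)\}_{n\ge1}$ such that for every sufficiently large $n$ and each $i\in[n]$ one of the following two conditions holds: (i) $P\{P(X_j>X_i\mid X_i)-P(X_j>X_i)\in[\delta_n,1],\ \forall j\in[n]\setminus\{i\}\}\ge p_n$; (ii) $P\{P(X_j>X_i\mid X_i)-P(X_j>X_i)\in[-1,-\delta_n],\ \forall j\in[n]\setminus\{i\}\}\ge p_n$. If in addition $\delta_n^3p_n\gnsim n^{-1/3}$, then $$\mathrm{Var}(U_n^{\rm Ken})^{-1/2}\{U_n^{\rm Ken}-E(U_n^{\rm Ken})\}\stackrel{d}{\to}N(0,1).$$ If in addition $\delta_n^3p_n\gnsim n^{-1/3}(\log n)^2$, then $$\mathrm{Var}(U_n^{\rm AP})^{-1/2}\{U_n^{\rm AP}-E(U_n^{\rm AP})\}\stackrel{d}{\to}N(0,1).$$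
   Context: For each $n$, $X_1,\dots,X_n$ (short for $X_{n,1},\dots,X_{n,n}$, a triangular array) are independent real random variables, not necessarily identically distributed, with distributions $P_1,\dots,P_n$ (which may change with $n$) absolutely continuous with respect to Lebesgue measure. $[n]=\{1,\dots,n\}$, $\mathbf 1(\cdot)$ is the indicator function, and $$U_n^{\rm Ken}=\frac{1}{n(n-1)}\sum_{i\ne j}\mathbf 1(j<i)\mathbf 1(X_j>X_i),\qquad U_n^{\rm AP}=\frac{1}{n(n-1)}\sum_{i\ne j}\frac{n\mathbf 1(j<i)}{i-1}\mathbf 1(X_j>X_i),$$ with sums over ordered pairs $i\neq j$ in $[n]$ and $0/0:=0$. (These are affine transforms of Kendall's tau and the average-precision correlation.) Order notation: $a_n\lesssim b_n$ (equivalently $b_n\gtrsim a_n$) means there is an absolute constant $C$ with $|a_n|\le C|b_n|$ for all sufficiently large $n$; $a_n\gnsim b_n$ means $a_n\gtrsim b_n$ holds but $a_n\lesssim b_n$ does not. *)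

theory Defs
  imports "HOL-Probability.Probability" "HOL-Library.Landau_Symbols"
begin

text \<open>
  Rows of the triangular array are indexed by \<open>{1..n}\<close>; the values of row \<open>n\<close> at a sample point
  are passed as a function \<open>x\<close>, read on \<open>{1..n}\<close> only. The convention \<open>0 / 0 = 0\<close> is that of HOL.
\<close>

definition U_Ken :: "nat \<Rightarrow> (nat \<Rightarrow> real) \<Rightarrow> real" where
  "U_Ken n x = 1 / (real n * (real n - 1)) *
     (\<Sum>i\<in>{1..n}. \<Sum>j\<in>{1..n} - {i}. of_bool (j < i) * of_bool (x j > x i))"

definition U_AP :: "nat \<Rightarrow> (nat \<Rightarrow> real) \<Rightarrow> real" where
  "U_AP n x = 1 / (real n * (real n - 1)) *
     (\<Sum>i\<in>{1..n}. \<Sum>j\<in>{1..n} - {i}.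
        real n * of_bool (j < i) / (real i - 1) * of_bool (x j > x i))"

definition cond_prob_given :: "'a measure \<Rightarrow> 'a set \<Rightarrow> ('a \<Rightarrow> real) \<Rightarrow> 'a \<Rightarrow> real" where
  "cond_prob_given M A Y =
     real_cond_exp M (vimage_algebra (space M) Y borel) (indicator A)"

text \<open>
  \<open>P(X\<^sub>j > X\<^sub>i | X\<^sub>i) - P(X\<^sub>j > X\<^sub>i)\<close> as a random variable. It is determined up to a null set, so
  the probabilities below do not depend on the version chosen by \<^const>\<open>real_cond_exp\<close>.
\<close>

definition excess :: "'a measure \<Rightarrow> (nat \<Rightarrow> 'a \<Rightarrow> real) \<Rightarrow> nat \<Rightarrow> nat \<Rightarrow> 'a \<Rightarrow> real" where
  "excess M X i j \<omega> =
     cond_prob_given M {\<omega>' \<in> space M. X j \<omega>' > X i \<omega>'} (X i) \<omega>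
     - measure M {\<omega>' \<in> space M. X j \<omega>' > X i \<omega>'}"

text \<open>
  \<open>a\<^sub>n\<close> bounds \<open>b\<^sub>n\<close> from above up to a constant, but not conversely. This is weaker than
  \<open>b\<^sub>n = o(a\<^sub>n)\<close>: the ratio \<open>a\<^sub>n / b\<^sub>n\<close> need only be unbounded, not tend to infinity.
\<close>

definition gnsim :: "(nat \<Rightarrow> real) \<Rightarrow> (nat \<Rightarrow> real) \<Rightarrow> bool" where
  "gnsim a b \<longleftrightarrow> b \<in> O(a) \<and> a \<notin> O(b)"

definition standardized :: "'a measure \<Rightarrow> ('a \<Rightarrow> real) \<Rightarrow> 'a \<Rightarrow> real" where
  "standardized M Y \<omega> =
     prob_space.variance M Y powr (- 1 / 2) * (Y \<omega> - prob_space.expectation M Y)"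

end

theory Submission
  imports Defs "HOL-Real_Asymp.Real_Asymp"
begin

text \<open>
  Up to the factor \<open>1 / (n - 1)\<close>, both statistics are weighted discordance counts
  \<open>\<Sum>\<^sub>i v\<^sub>i \<Sum>\<^sub>j\<^sub><\<^sub>i 1(X\<^sub>j > X\<^sub>i)\<close>, with \<open>v\<^sub>i = 1 / n\<close> for Kendall's statistic and \<open>v\<^sub>i = 1 / (i - 1)\<close>
  for the average-precision one, and standardizing removes the factor.

  The Hoeffding decomposition (\<open>hoeffding_decomposition\<close>) writes such a count as a constant, plus
  a sum of independent centred terms \<open>L\<^sub>i(X\<^sub>i)\<close>, plus a remainder built from kernels of two
  variables that integrate to zero in each variable. The \<open>L\<^sub>i\<close> are bounded by some \<open>B\<close>
  (\<open>B = 1\<close> for Kendall, \<open>B = O(log n)\<close> for average precision). The kernels of distinct pairs are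
  orthogonal, so the second moment of the remainder is at most \<open>4 B\<^sup>2\<close>
  (\<open>second_moment_remainder_le\<close>), and the remainder is orthogonal to the linear part.

  The hypothesis on the conditional probabilities bounds the variance from below. In \<open>L\<^sub>i\<close> the
  indices \<open>j < i\<close> contribute \<open>v\<^sub>i\<close> times the sum of \<open>P(X\<^sub>j > X\<^sub>i | X\<^sub>i) - P(X\<^sub>j > X\<^sub>i)\<close>, while those
  with \<open>j > i\<close> enter with the opposite sign. If \<open>i\<close> is among the last \<open>\<delta> n / 4\<close> indices there are so
  few of the latter that on the event of probability \<open>p\<close> the first part wins by \<open>\<delta> / 4\<close>; so
  \<open>E L\<^sub>i\<^sup>2 \<ge> (\<delta> / 4)\<^sup>2 p\<close> (\<open>second_moment_projection_ge\<close>), and about \<open>\<delta> n / 4\<close> such indices give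
  variance at least \<open>n \<delta>\<^sup>3 p / 64\<close>.

  Everything is therefore governed by the single ratio \<open>B\<^sup>2 / (n \<delta>\<^sup>3 p)\<close>: up to
  constants, it bounds both the second moment of the remainder and the square of the largest summand
  relative to the variance. A bounded
  central limit theorem with explicit error for the characteristic function
  (\<open>char_standardized_approx\<close>) turns this into an error that vanishes with the ratio, and Levy's
  continuity theorem concludes. The assumed rates give \<open>n \<delta>\<^sup>3 p \<ge> c n powr (2/3)\<close> for large \<open>n\<close>,
  which dominates \<open>(log n)\<^sup>2\<close>.
\<close>


section \<open>Characteristic functions of sums of bounded independent variables\<close>

lemma (in prob_space) integrable_bounded:
  fixes f :: "'a \<Rightarrow> real"
  assumes "f \<in> borel_measurable M" "\<And>\<omega>. \<bar>f \<omega>\<bar> \<le> C"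
  shows "integrable M f"
  by (rule integrable_const_bound[where B = C]) (use assms in auto)

text \<open>
  Fubini: \<open>X i\<close> is independent of the tuple of the other three variables and occurs only in
  the second argument of \<open>r\<close>, so it can be integrated out first. The indices
  \<open>j\<close>, \<open>k\<close>, \<open>l\<close> may coincide, as they do when two kernels share a variable. The orthogonality
  relations below and the identification of the conditional probabilities all rest on this lemma.
\<close>

lemma (in prob_space) expectation_mult_eq_0_if_section_eq_0:
  fixes X :: "'i \<Rightarrow> 'a \<Rightarrow> real" and r g :: "real \<Rightarrow> real \<Rightarrow> real"
  assumes indep: "indep_vars (\<lambda>_. borel) X I"
    and I: "i \<in> I" "j \<in> I" "k \<in> I" "l \<in> I" "i \<notin> {j, k, l}"
    and r [measurable]: "case_prod r \<in> borel_measurable (borel \<Otimes>\<^sub>M borel)"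
    and g [measurable]: "case_prod g \<in> borel_measurable (borel \<Otimes>\<^sub>M borel)"
    and r_bound: "\<And>x y. \<bar>r x y\<bar> \<le> C" and g_bound: "\<And>x y. \<bar>g x y\<bar> \<le> D"
    and zero: "\<And>x. expectation (\<lambda>\<omega>. r x (X i \<omega>)) = 0"
  shows "expectation (\<lambda>\<omega>. r (X j \<omega>) (X i \<omega>) * g (X k \<omega>) (X l \<omega>)) = 0"
proof -
  let ?A = "{j, k, l}"
  let ?N = "PiM ?A (\<lambda>_. borel :: real measure)"
  let ?Z = "\<lambda>\<omega>. restrict (\<lambda>m. X m \<omega>) ?A"
  let ?N' = "PiM {i} (\<lambda>_. borel :: real measure)"
  let ?W = "\<lambda>\<omega>. restrict (\<lambda>m. X m \<omega>) {i}"
  have [measurable]: "X i \<in> borel_measurable M"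
    using indep I by (auto simp: indep_vars_def)
  have Z_Xi: "indep_var ?N ?Z ?N' ?W"
    using I by (intro indep_var_restrict[OF indep]) auto
  then have [measurable]: "?Z \<in> measurable M ?N" "?W \<in> measurable M ?N'"
    by (auto dest: indep_var_rv1 indep_var_rv2)
  let ?P = "distr M ?N ?Z" and ?Q = "distr M ?N' ?W"
  interpret P: prob_space ?P by (rule prob_space_distr) simp
  interpret Q: prob_space ?Q by (rule prob_space_distr) simp
  interpret PQ: pair_prob_space ?P ?Q ..
  have joint: "?P \<Otimes>\<^sub>M ?Q = distr M (?N \<Otimes>\<^sub>M ?N') (\<lambda>\<omega>. (?Z \<omega>, ?W \<omega>))"
    using Z_Xi by (simp add: indep_var_distribution_eq)
  define \<phi> where "\<phi> = (\<lambda>zy. r (fst zy j) (snd zy i) * g (fst zy k) (fst zy l))"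
  have coord [measurable]: "(\<lambda>z. z m) \<in> measurable ?N borel" if "m \<in> ?A" for m
    using that by (rule measurable_component_singleton)
  have [measurable]: "(\<lambda>z. z j) \<in> measurable ?N borel" "(\<lambda>z. z k) \<in> measurable ?N borel"
    "(\<lambda>z. z l) \<in> measurable ?N borel"
    by (rule coord; simp)+
  have [measurable]: "(\<lambda>w. w i) \<in> measurable ?N' borel"
    by (rule measurable_component_singleton) simp
  have rm: "(\<lambda>\<omega>. r (f \<omega>) (h \<omega>)) \<in> borel_measurable K"
    if "f \<in> borel_measurable K" "h \<in> borel_measurable K" for K :: "'c measure" and f h
    using measurable_compose[OF measurable_Pair[OF that] r] by simp
  have gm: "(\<lambda>\<omega>. g (f \<omega>) (h \<omega>)) \<in> borel_measurable K"
    if "f \<in> borel_measurable K" "h \<in> borel_measurable K" for K :: "'c measure" and f h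
    using measurable_compose[OF measurable_Pair[OF that] g] by simp
  have \<phi>_m [measurable]: "\<phi> \<in> borel_measurable (?N \<Otimes>\<^sub>M ?N')"
    unfolding \<phi>_def by (intro borel_measurable_times rm gm) measurable
  have "\<bar>\<phi> zy\<bar> \<le> C * D" for zy
    unfolding \<phi>_def abs_mult
    by (intro mult_mono r_bound g_bound order_trans[OF abs_ge_zero r_bound]) auto
  then have "integrable (?P \<Otimes>\<^sub>M ?Q) \<phi>"
    by (intro PQ.P.integrable_bounded[where C = "C * D"]) auto
  then have fub: "integral\<^sup>L (?P \<Otimes>\<^sub>M ?Q) \<phi> = (\<integral>z. (\<integral>y. \<phi> (z, y) \<partial>?Q) \<partial>?P)"
    by (rule PQ.integral_fst'[symmetric])
  have inner: "(\<integral>y. \<phi> (z, y) \<partial>?Q) = 0" for z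
  proof -
    have [measurable]: "(\<lambda>w. r (z j) (w i)) \<in> borel_measurable ?N'"
      by (rule rm) measurable
    have "(\<integral>y. \<phi> (z, y) \<partial>?Q) = (\<integral>y. r (z j) (y i) \<partial>?Q) * g (z k) (z l)"
      by (simp add: \<phi>_def)
    also have "(\<integral>y. r (z j) (y i) \<partial>?Q) = 0"
      using zero[of "z j"] by (subst integral_distr) auto
    finally show ?thesis unfolding mult_zero_left .
  qed
  have "expectation (\<lambda>\<omega>. r (X j \<omega>) (X i \<omega>) * g (X k \<omega>) (X l \<omega>))
      = expectation (\<lambda>\<omega>. \<phi> (?Z \<omega>, ?W \<omega>))"
    by (simp add: \<phi>_def)
  also have "\<dots> = integral\<^sup>L (?P \<Otimes>\<^sub>M ?Q) \<phi>"
    unfolding joint by (subst integral_distr) auto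
  also have "\<dots> = 0"
    using fub inner by simp
  finally show ?thesis .
qed

lemma (in prob_space) expectation_abs_le_sqrt:
  fixes f :: "'a \<Rightarrow> real"
  assumes [measurable]: "f \<in> borel_measurable M" and b: "\<And>\<omega>. \<bar>f \<omega>\<bar> \<le> C"
  shows "expectation (\<lambda>\<omega>. \<bar>f \<omega>\<bar>) \<le> sqrt (expectation (\<lambda>\<omega>. (f \<omega>)\<^sup>2))"
proof -
  have i1: "integrable M (\<lambda>\<omega>. \<bar>f \<omega>\<bar>)"
    by (rule integrable_bounded[where C = C]) (use b in auto)
  have i2: "integrable M (\<lambda>\<omega>. \<bar>f \<omega>\<bar>\<^sup>2)"
    by (rule integrable_bounded[where C = "C\<^sup>2"])
      (use power_mono[OF b, of _ 2] in \<open>auto simp: power2_abs\<close>)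
  have "0 \<le> variance (\<lambda>\<omega>. \<bar>f \<omega>\<bar>)" by (rule variance_positive)
  also have "\<dots> = expectation (\<lambda>\<omega>. (f \<omega>)\<^sup>2) - (expectation (\<lambda>\<omega>. \<bar>f \<omega>\<bar>))\<^sup>2"
    using variance_eq[OF i1 i2] by simp
  finally show ?thesis
    by (intro real_le_rsqrt) simp
qed

text \<open>
  Since \<open>s \<mapsto> exp (\<i> t s)\<close> is Lipschitz with constant \<open>\<bar>t\<bar>\<close>, a perturbation that is small in mean
  square moves the characteristic function little. This replaces Slutsky's lemma and keeps the
  error explicit.
\<close>

lemma (in prob_space) char_distr_diff_le:
  fixes S R :: "'a \<Rightarrow> real"
  assumes [measurable]: "S \<in> borel_measurable M" "R \<in> borel_measurable M"
    and b: "\<And>\<omega>. \<bar>R \<omega>\<bar> \<le> C"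
  shows "cmod (char (distr M borel (\<lambda>\<omega>. S \<omega> + R \<omega>)) t - char (distr M borel S) t)
      \<le> \<bar>t\<bar> * sqrt (expectation (\<lambda>\<omega>. (R \<omega>)\<^sup>2))"
proof -
  have lip: "cmod (iexp (t * (s + r)) - iexp (t * s)) \<le> \<bar>t\<bar> * \<bar>r\<bar>" for s r
  proof -
    have "iexp (t * (s + r)) - iexp (t * s) = iexp (t * s) * (iexp (t * r) - 1)"
      by (simp add: algebra_simps exp_add)
    then have "cmod (iexp (t * (s + r)) - iexp (t * s)) = cmod (iexp (t * r) - 1)"
      by (simp add: norm_mult)
    also have "\<dots> \<le> \<bar>t * r\<bar>"
      using iexp_approx1[of "t * r" 0] by simp
    finally show ?thesis by (simp add: abs_mult)
  qed
  have int: "integrable M (\<lambda>\<omega>. iexp (t * f \<omega>))" if [measurable]: "f \<in> borel_measurable M" for f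
    by (rule integrable_const_bound[where B = 1]) auto
  have iR: "integrable M (\<lambda>\<omega>. \<bar>R \<omega>\<bar>)"
    by (rule integrable_bounded[where C = C]) (use b in auto)
  have "char (distr M borel (\<lambda>\<omega>. S \<omega> + R \<omega>)) t - char (distr M borel S) t
      = (CLINT \<omega>|M. iexp (t * (S \<omega> + R \<omega>)) - iexp (t * S \<omega>))"
    using int[of "\<lambda>\<omega>. S \<omega> + R \<omega>"] int[of S] by (simp add: char_def integral_distr)
  also have "cmod \<dots> \<le> expectation (\<lambda>\<omega>. cmod (iexp (t * (S \<omega> + R \<omega>)) - iexp (t * S \<omega>)))"
    by (rule integral_norm_bound)
  also have "\<dots> \<le> expectation (\<lambda>\<omega>. \<bar>t\<bar> * \<bar>R \<omega>\<bar>)"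
    using int[of "\<lambda>\<omega>. S \<omega> + R \<omega>"] int[of S] iR lip by (intro integral_mono) auto
  also have "\<dots> = \<bar>t\<bar> * expectation (\<lambda>\<omega>. \<bar>R \<omega>\<bar>)"
    by simp
  also have "\<dots> \<le> \<bar>t\<bar> * sqrt (expectation (\<lambda>\<omega>. (R \<omega>)\<^sup>2))"
    by (intro mult_left_mono expectation_abs_le_sqrt[of _ C]) (use b in auto)
  finally show ?thesis .
qed

lemma one_minus_minus_exp_le:
  fixes x :: real
  assumes "0 \<le> x"
  shows "\<bar>1 - x - exp (- x)\<bar> \<le> x\<^sup>2 / 2"
proof -
  have "exp (- x) \<le> 1 - x + x\<^sup>2 / 2"
  proof -
    have "(\<lambda>y. 1 - y + y\<^sup>2 / 2 - exp (- y)) 0 \<le> (\<lambda>y. 1 - y + y\<^sup>2 / 2 - exp (- y)) x"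
    proof (rule DERIV_nonneg_imp_nondecreasing[OF assms])
      fix y :: real assume "0 \<le> y"
      have "((\<lambda>y. 1 - y + y\<^sup>2 / 2 - exp (- y)) has_real_derivative (- 1 + y + exp (- y))) (at y)"
        by (auto intro!: derivative_eq_intros)
      moreover have "0 \<le> - 1 + y + exp (- y)"
        using exp_ge_add_one_self[of "- y"] by simp
      ultimately show "\<exists>d. ((\<lambda>y. 1 - y + y\<^sup>2 / 2 - exp (- y)) has_real_derivative d) (at y) \<and> 0 \<le> d"
        by blast
    qed
    then show ?thesis by simp
  qed
  moreover have "1 - x \<le> exp (- x)"
    using exp_ge_add_one_self[of "- x"] by simp
  ultimately show ?thesis by simp
qed

text \<open>
  The second-order expansion has a third-moment error, and boundedness gives
  \<open>E \<bar>Y\<bar>\<^sup>3 \<le> b E Y\<^sup>2\<close>. Likewise the error of \<open>1 - x \<approx> exp (- x)\<close> at \<open>x = t\<^sup>2 v / 2\<close> is of order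
  \<open>v\<^sup>2 \<le> b\<^sup>2 v\<close>. Both errors are thus proportional to the variance \<open>v\<close> and can be summed over
  many variables.
\<close>

lemma (in prob_space) char_centred_bounded_approx:
  fixes Y :: "'a \<Rightarrow> real"
  assumes [measurable]: "Y \<in> borel_measurable M" and b: "\<And>\<omega>. \<bar>Y \<omega>\<bar> \<le> b"
    and mean: "expectation Y = 0"
  defines "v \<equiv> expectation (\<lambda>\<omega>. (Y \<omega>)\<^sup>2)"
  shows "cmod (char (distr M borel Y) t - exp (- (t\<^sup>2 * v / 2))) \<le> v * (\<bar>t\<bar> ^ 3 * b / 6 + t ^ 4 * b\<^sup>2 / 8)"
proof -
  have sq: "(Y \<omega>)\<^sup>2 \<le> b\<^sup>2" for \<omega>
    using power_mono[OF b, of \<omega> 2] by simp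
  have i1: "integrable M Y" by (rule integrable_bounded[OF _ b]) simp
  have i2: "integrable M (\<lambda>\<omega>. (Y \<omega>)\<^sup>2)"
    by (rule integrable_bounded[where C = "b\<^sup>2"]) (use sq in auto)
  have b0: "0 \<le> b" using b[of undefined] by linarith
  have v0: "0 \<le> v" unfolding v_def by simp
  have vb: "v \<le> b\<^sup>2"
  proof -
    have "v \<le> expectation (\<lambda>_. b\<^sup>2)"
      unfolding v_def using i2 sq by (intro integral_mono) auto
    then show ?thesis by (simp add: prob_space)
  qed
  have "cmod (char (distr M borel Y) t - (1 - t\<^sup>2 * v / 2))
      \<le> t\<^sup>2 / 6 * expectation (\<lambda>\<omega>. min (6 * (Y \<omega>)\<^sup>2) (\<bar>t\<bar> * \<bar>Y \<omega>\<bar> ^ 3))"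
    by (rule char_approx3'[OF _ i1 i2 mean]) (simp_all add: mean v_def)
  also have "\<dots> \<le> t\<^sup>2 / 6 * (\<bar>t\<bar> * b * v)"
  proof (intro mult_left_mono)
    have "min (6 * (Y \<omega>)\<^sup>2) (\<bar>t\<bar> * \<bar>Y \<omega>\<bar> ^ 3) \<le> \<bar>t\<bar> * b * (Y \<omega>)\<^sup>2" for \<omega>
    proof -
      have "\<bar>t\<bar> * \<bar>Y \<omega>\<bar> ^ 3 = \<bar>t\<bar> * (\<bar>Y \<omega>\<bar> * (Y \<omega>)\<^sup>2)"
        by (cases "0 \<le> Y \<omega>") (auto simp: power3_eq_cube power2_eq_square)
      also have "\<dots> \<le> \<bar>t\<bar> * (b * (Y \<omega>)\<^sup>2)"
        by (intro mult_left_mono mult_right_mono b) auto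
      finally show ?thesis by (simp add: mult.assoc)
    qed
    moreover have "integrable M (\<lambda>\<omega>. min (6 * (Y \<omega>)\<^sup>2) (\<bar>t\<bar> * \<bar>Y \<omega>\<bar> ^ 3))"
    proof (rule integrable_bounded[where C = "6 * b\<^sup>2"])
      show "\<bar>min (6 * (Y \<omega>)\<^sup>2) (\<bar>t\<bar> * \<bar>Y \<omega>\<bar> ^ 3)\<bar> \<le> 6 * b\<^sup>2" for \<omega>
      proof -
        have "0 \<le> \<bar>t\<bar> * \<bar>Y \<omega>\<bar> ^ 3" "0 \<le> (Y \<omega>)\<^sup>2" by auto
        with sq[of \<omega>] show ?thesis by linarith
      qed
    qed simp
    ultimately have "expectation (\<lambda>\<omega>. min (6 * (Y \<omega>)\<^sup>2) (\<bar>t\<bar> * \<bar>Y \<omega>\<bar> ^ 3))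
        \<le> expectation (\<lambda>\<omega>. \<bar>t\<bar> * b * (Y \<omega>)\<^sup>2)"
      using i2 by (intro integral_mono) auto
    then show "expectation (\<lambda>\<omega>. min (6 * (Y \<omega>)\<^sup>2) (\<bar>t\<bar> * \<bar>Y \<omega>\<bar> ^ 3)) \<le> \<bar>t\<bar> * b * v"
      by (simp add: v_def)
  qed simp
  also have "\<dots> = v * (\<bar>t\<bar> ^ 3 * b / 6)"
    by (cases "0 \<le> t") (auto simp: power3_eq_cube power2_eq_square)
  finally have 1: "cmod (char (distr M borel Y) t - (1 - t\<^sup>2 * v / 2)) \<le> v * (\<bar>t\<bar> ^ 3 * b / 6)" .
  have "cmod ((1 - t\<^sup>2 * v / 2) - exp (- (t\<^sup>2 * v / 2))) = \<bar>1 - t\<^sup>2 * v / 2 - exp (- (t\<^sup>2 * v / 2))\<bar>"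
    by (subst norm_of_real[where 'a = complex, symmetric]) (simp add: exp_of_real)
  also have "\<dots> \<le> (t\<^sup>2 * v / 2)\<^sup>2 / 2"
    by (rule one_minus_minus_exp_le) (use v0 in simp)
  also have "\<dots> = t ^ 4 / 8 * (v * v)"
    by (simp add: power2_eq_square power4_eq_xxxx)
  also have "\<dots> \<le> t ^ 4 / 8 * (v * b\<^sup>2)"
    by (intro mult_left_mono vb v0) simp
  finally have 2: "cmod ((1 - t\<^sup>2 * v / 2) - exp (- (t\<^sup>2 * v / 2))) \<le> v * (t ^ 4 * b\<^sup>2 / 8)"
    by (simp add: ac_simps)
  have "cmod (char (distr M borel Y) t - exp (- (t\<^sup>2 * v / 2)))
      \<le> cmod (char (distr M borel Y) t - (1 - t\<^sup>2 * v / 2)) + cmod ((1 - t\<^sup>2 * v / 2) - exp (- (t\<^sup>2 * v / 2)))"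
    using norm_triangle_ineq[of "char (distr M borel Y) t - (1 - t\<^sup>2 * v / 2)"
        "(1 - t\<^sup>2 * v / 2) - exp (- (t\<^sup>2 * v / 2))"] by simp
  with 1 2 show ?thesis by (simp only: distrib_left)
qed

lemma (in prob_space) char_sum_centred_bounded_approx:
  fixes Y :: "'i \<Rightarrow> 'a \<Rightarrow> real"
  assumes indep: "indep_vars (\<lambda>_. borel) Y I" and b: "\<And>i \<omega>. i \<in> I \<Longrightarrow> \<bar>Y i \<omega>\<bar> \<le> b"
    and mean: "\<And>i. i \<in> I \<Longrightarrow> expectation (Y i) = 0" and fin: "finite I"
  defines "v \<equiv> (\<Sum>i\<in>I. expectation (\<lambda>\<omega>. (Y i \<omega>)\<^sup>2))"
  shows "cmod (char (distr M borel (\<lambda>\<omega>. \<Sum>i\<in>I. Y i \<omega>)) t - exp (- (t\<^sup>2 * v / 2)))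
    \<le> v * (\<bar>t\<bar> ^ 3 * b / 6 + t ^ 4 * b\<^sup>2 / 8)"
proof -
  let ?v = "\<lambda>i. expectation (\<lambda>\<omega>. (Y i \<omega>)\<^sup>2)"
  have [measurable]: "Y i \<in> borel_measurable M" if "i \<in> I" for i
    using indep that by (auto simp: indep_vars_def)
  have e: "complex_of_real (exp (- (t\<^sup>2 * v / 2))) = (\<Prod>i\<in>I. complex_of_real (exp (- (t\<^sup>2 * ?v i / 2))))"
    unfolding of_real_prod[symmetric] exp_sum[OF fin, symmetric]
    by (simp add: v_def sum_distrib_left sum_divide_distrib sum_negf del: of_real_exp)
  have "cmod (char (distr M borel (\<lambda>\<omega>. \<Sum>i\<in>I. Y i \<omega>)) t - complex_of_real (exp (- (t\<^sup>2 * v / 2))))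
    = cmod ((\<Prod>i\<in>I. char (distr M borel (Y i)) t) - (\<Prod>i\<in>I. complex_of_real (exp (- (t\<^sup>2 * ?v i / 2)))))"
    unfolding e by (subst char_distr_sum[OF indep]) simp
  also have "\<dots> \<le> (\<Sum>i\<in>I. cmod (char (distr M borel (Y i)) t - complex_of_real (exp (- (t\<^sup>2 * ?v i / 2)))))"
  proof (rule norm_prod_diff)
    fix i assume i: "i \<in> I"
    interpret D: real_distribution "distr M borel (Y i)"
      by (rule real_distribution_distr) (use i in simp)
    show "cmod (char (distr M borel (Y i)) t) \<le> 1" by (rule D.cmod_char_le_1)
    show "cmod (complex_of_real (exp (- (t\<^sup>2 * ?v i / 2)))) \<le> 1" by (simp del: of_real_exp)
  qed
  also have "\<dots> \<le> (\<Sum>i\<in>I. ?v i * (\<bar>t\<bar> ^ 3 * b / 6 + t ^ 4 * b\<^sup>2 / 8))"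
    using b mean char_centred_bounded_approx[of "Y _" b t]
    by (intro sum_mono) (simp add: exp_of_real)
  also have "\<dots> = v * (\<bar>t\<bar> ^ 3 * b / 6 + t ^ 4 * b\<^sup>2 / 8)"
    by (simp only: v_def sum_distrib_right)
  finally show ?thesis by (simp add: exp_of_real)
qed

lemma abs_exp_minus_diff_le:
  fixes x y :: real
  assumes "0 \<le> x" "x \<le> y"
  shows "\<bar>exp (- x) - exp (- y)\<bar> \<le> y - x"
proof -
  have "exp (- x) - exp (- y) = exp (- x) * (1 - exp (- (y - x)))"
    by (simp add: algebra_simps flip: exp_add)
  also have "\<dots> \<le> 1 * (y - x)"
  proof (intro mult_mono)
    show "1 - exp (- (y - x)) \<le> y - x"
      using exp_ge_add_one_self[of "- (y - x)"] by linarith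
  qed (use assms in auto)
  finally show ?thesis using assms by simp
qed

lemma (in prob_space) second_moment_indep_sum:
  fixes Y :: "'i \<Rightarrow> 'a \<Rightarrow> real"
  assumes indep: "indep_vars (\<lambda>_. borel) Y I" and b: "\<And>i \<omega>. i \<in> I \<Longrightarrow> \<bar>Y i \<omega>\<bar> \<le> b"
    and mean: "\<And>i. i \<in> I \<Longrightarrow> expectation (Y i) = 0" and fin: "finite I"
  shows "expectation (\<lambda>\<omega>. (\<Sum>i\<in>I. Y i \<omega>)\<^sup>2) = (\<Sum>i\<in>I. expectation (\<lambda>\<omega>. (Y i \<omega>)\<^sup>2))"
proof -
  have [measurable]: "Y i \<in> borel_measurable M" if "i \<in> I" for i
    using indep that by (auto simp: indep_vars_def)
  have int: "integrable M (\<lambda>\<omega>. Y i \<omega> * Y j \<omega>)" if "i \<in> I" "j \<in> I" for i j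
  proof (rule integrable_bounded[where C = "b * b"])
    show "\<bar>Y i \<omega> * Y j \<omega>\<bar> \<le> b * b" for \<omega>
      unfolding abs_mult using that by (intro mult_mono b order_trans[OF abs_ge_zero b]) auto
  qed (use that in simp)
  have zero: "expectation (\<lambda>\<omega>. Y i \<omega> * Y j \<omega>) = 0" if "i \<in> I" "j \<in> I" "i \<noteq> j" for i j
  proof -
    have "expectation (\<lambda>\<omega>. \<Prod>k\<in>{i, j}. Y k \<omega>) = (\<Prod>k\<in>{i, j}. expectation (Y k))"
    proof (rule indep_vars_lebesgue_integral)
      show "indep_vars (\<lambda>_. borel) Y {i, j}"
        by (rule indep_vars_subset[OF indep]) (use that in auto)
      show "integrable M (Y k)" if "k \<in> {i, j}" for k
        by (rule integrable_bounded[where C = b]) (use that \<open>i \<in> I\<close> \<open>j \<in> I\<close> b in auto)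
    qed simp
    then show ?thesis using that mean by simp
  qed
  have "expectation (\<lambda>\<omega>. (\<Sum>i\<in>I. Y i \<omega>)\<^sup>2) = (\<Sum>i\<in>I. \<Sum>j\<in>I. expectation (\<lambda>\<omega>. Y i \<omega> * Y j \<omega>))"
    using int by (simp add: power2_eq_square sum_product)
  also have "\<dots> = (\<Sum>i\<in>I. \<Sum>j\<in>I. if i = j then expectation (\<lambda>\<omega>. (Y i \<omega>)\<^sup>2) else 0)"
    by (intro sum.cong refl) (auto simp: zero power2_eq_square)
  finally show ?thesis using fin by simp
qed

text \<open>
  A row-wise central limit theorem with explicit error, for a sum of independent bounded terms
  contaminated by a remainder orthogonal to each of them. Orthogonality makes the variance of \<open>U\<close>
  the sum of both variances, hence at least \<open>S\<close>; measured against \<open>S\<close>, the number \<open>\<epsilon>\<close> bounds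
  the squared size of the summands and the variance of the remainder. Of the error terms, the
  first comes from deleting the remainder, those with \<open>\<bar>t\<bar> ^ 3\<close> and \<open>t ^ 4\<close> from the expansion of the factors, and
  the one with \<open>t\<^sup>2 / 2\<close> from the variance of the linear part falling short of one.
\<close>

lemma (in prob_space) char_standardized_approx:
  fixes Y :: "'i \<Rightarrow> 'a \<Rightarrow> real" and R U :: "'a \<Rightarrow> real"
  assumes indep: "indep_vars (\<lambda>_. borel) Y I" and b: "\<And>i \<omega>. i \<in> I \<Longrightarrow> \<bar>Y i \<omega>\<bar> \<le> b"
    and mean: "\<And>i. i \<in> I \<Longrightarrow> expectation (Y i) = 0" and fin: "finite I"
    and R [measurable]: "R \<in> borel_measurable M" and R_bound: "\<And>\<omega>. \<bar>R \<omega>\<bar> \<le> C"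
    and R_mean: "expectation R = 0"
    and orth: "\<And>i. i \<in> I \<Longrightarrow> expectation (\<lambda>\<omega>. Y i \<omega> * R \<omega>) = 0"
    and U: "\<And>\<omega>. \<omega> \<in> space M \<Longrightarrow> U \<omega> = \<mu> + (\<Sum>i\<in>I. Y i \<omega>) + R \<omega>"
    and S: "0 < S" "S \<le> (\<Sum>i\<in>I. expectation (\<lambda>\<omega>. (Y i \<omega>)\<^sup>2))"
    and b_small: "b\<^sup>2 \<le> \<epsilon> * S" and R_small: "expectation (\<lambda>\<omega>. (R \<omega>)\<^sup>2) \<le> \<epsilon> * S"
  shows "cmod (char (distr M borel (standardized M U)) t - exp (- (t\<^sup>2) / 2))
    \<le> (\<bar>t\<bar> + \<bar>t\<bar> ^ 3 / 6) * sqrt \<epsilon> + (t ^ 4 / 8 + t\<^sup>2 / 2) * \<epsilon>"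
proof -
  have Ym [measurable]: "Y i \<in> borel_measurable M" if "i \<in> I" for i
    using indep that by (auto simp: indep_vars_def)
  define H where "H = (\<lambda>\<omega>. \<Sum>i\<in>I. Y i \<omega>)"
  have Hm [measurable]: "H \<in> borel_measurable M" unfolding H_def by measurable
  define s2 where "s2 = (\<Sum>i\<in>I. expectation (\<lambda>\<omega>. (Y i \<omega>)\<^sup>2))"
  define q where "q = expectation (\<lambda>\<omega>. (R \<omega>)\<^sup>2)"
  have q0: "0 \<le> q" unfolding q_def by simp
  have s2: "0 < s2" "S \<le> s2" using S by (auto simp: s2_def)
  have C0: "0 \<le> C" using R_bound[of undefined] by linarith
  have H_bound: "\<bar>H \<omega>\<bar> \<le> real (card I) * b" for \<omega>
  proof -
    have "\<bar>H \<omega>\<bar> \<le> (\<Sum>i\<in>I. \<bar>Y i \<omega>\<bar>)" unfolding H_def by (rule sum_abs)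
    also have "\<dots> \<le> (\<Sum>i\<in>I. b)" by (intro sum_mono b)
    finally show ?thesis by simp
  qed
  have iY: "integrable M (Y i)" if "i \<in> I" for i
    by (rule integrable_bounded[where C = b]) (use that b in auto)
  have iR: "integrable M R" by (rule integrable_bounded[OF _ R_bound]) simp
  have iH: "integrable M H" by (rule integrable_bounded[OF _ H_bound]) simp
  have iHH: "integrable M (\<lambda>\<omega>. (H \<omega>)\<^sup>2)"
    by (rule integrable_bounded[where C = "(real (card I) * b)\<^sup>2"])
      (use power_mono[OF H_bound, of _ 2] in auto)
  have iRR: "integrable M (\<lambda>\<omega>. (R \<omega>)\<^sup>2)"
    by (rule integrable_bounded[where C = "C\<^sup>2"]) (use power_mono[OF R_bound, of _ 2] in auto)
  have iYR: "integrable M (\<lambda>\<omega>. Y i \<omega> * R \<omega>)" if "i \<in> I" for i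
  proof (rule integrable_bounded[where C = "b * C"])
    show "\<bar>Y i \<omega> * R \<omega>\<bar> \<le> b * C" for \<omega>
      unfolding abs_mult using that by (intro mult_mono b R_bound order_trans[OF abs_ge_zero b]) auto
  qed (use that in simp)
  have iHR: "integrable M (\<lambda>\<omega>. H \<omega> * R \<omega>)"
    unfolding H_def sum_distrib_right using iYR by auto
  have EH: "expectation H = 0"
    unfolding H_def using iY mean by simp
  have EHR: "expectation (\<lambda>\<omega>. H \<omega> * R \<omega>) = 0"
    unfolding H_def sum_distrib_right using iYR orth by simp
  have EHH: "expectation (\<lambda>\<omega>. (H \<omega>)\<^sup>2) = s2"
    unfolding H_def s2_def by (rule second_moment_indep_sum[OF indep b mean fin])
  have EU: "expectation U = \<mu>"
  proof -
    have "expectation U = expectation (\<lambda>\<omega>. \<mu> + H \<omega> + R \<omega>)"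
      by (rule Bochner_Integration.integral_cong) (auto simp: U H_def)
    then show ?thesis using iH iR EH R_mean by (simp add: prob_space)
  qed
  have VU: "variance U = s2 + q"
  proof -
    have "variance U = expectation (\<lambda>\<omega>. (H \<omega>)\<^sup>2 + 2 * (H \<omega> * R \<omega>) + (R \<omega>)\<^sup>2)"
      unfolding EU by (rule Bochner_Integration.integral_cong)
        (auto simp: U H_def power2_eq_square algebra_simps)
    then show ?thesis using iHH iHR iRR EHH EHR by (simp add: q_def)
  qed
  define c where "c = 1 / sqrt (s2 + q)"
  have c2: "c\<^sup>2 = 1 / (s2 + q)" and c0: "0 < c"
    using s2 q0 by (simp_all add: c_def power_divide)
  have c2S: "c\<^sup>2 * S \<le> 1" using s2 q0 S by (simp add: c2 divide_le_eq)
  have \<epsilon>: "0 \<le> \<epsilon>"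
    using b_small S(1) by (meson zero_le_mult_iff order_trans zero_le_power2 not_less order_less_imp_le)
  have small: "c\<^sup>2 * x \<le> \<epsilon>" if "x \<le> \<epsilon> * S" for x
  proof -
    have "c\<^sup>2 * x \<le> c\<^sup>2 * (\<epsilon> * S)" by (intro mult_left_mono that) simp
    also have "\<dots> = \<epsilon> * (c\<^sup>2 * S)" by simp
    also have "\<dots> \<le> \<epsilon> * 1" by (intro mult_left_mono c2S \<epsilon>)
    finally show ?thesis by simp
  qed
  have std: "standardized M U \<omega> = c * H \<omega> + c * R \<omega>" if "\<omega> \<in> space M" for \<omega>
  proof -
    have "variance U powr (- 1 / 2) = c"
      using s2 q0 by (simp add: VU c_def powr_minus_divide powr_half_sqrt flip: minus_divide_left)
    then show ?thesis
      using that by (simp add: standardized_def EU U H_def algebra_simps)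
  qed
  have char_U: "char (distr M borel (standardized M U)) t = char (distr M borel (\<lambda>\<omega>. c * H \<omega> + c * R \<omega>)) t"
    by (rule arg_cong[where f = "\<lambda>N. char N t"], rule distr_cong) (auto simp: std)
  have cR2: "expectation (\<lambda>\<omega>. (c * R \<omega>)\<^sup>2) = c\<^sup>2 * q"
    by (simp add: power_mult_distrib q_def)
  have "cmod (char (distr M borel (standardized M U)) t - char (distr M borel (\<lambda>\<omega>. c * H \<omega>)) t)
      \<le> \<bar>t\<bar> * sqrt (c\<^sup>2 * q)"
    unfolding char_U cR2[symmetric]
  proof (rule char_distr_diff_le)
    show "\<bar>c * R \<omega>\<bar> \<le> c * C" for \<omega>
      unfolding abs_mult using c0 R_bound[of \<omega>] by simp
  qed measurable
  also have "\<dots> \<le> \<bar>t\<bar> * sqrt \<epsilon>"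
    using small[of q] R_small by (intro mult_left_mono) (auto simp: q_def)
  finally have 1: "cmod (char (distr M borel (standardized M U)) t - char (distr M borel (\<lambda>\<omega>. c * H \<omega>)) t)
      \<le> \<bar>t\<bar> * sqrt \<epsilon>" .
  have cY: "(\<Sum>i\<in>I. expectation (\<lambda>\<omega>. (c * Y i \<omega>)\<^sup>2)) = c\<^sup>2 * s2"
    by (simp add: power_mult_distrib s2_def sum_distrib_left)
  have \<tau>: "0 \<le> c\<^sup>2 * s2" "c\<^sup>2 * s2 \<le> 1" "1 - c\<^sup>2 * s2 = c\<^sup>2 * q"
    using s2 q0 by (auto simp: c2 field_simps)
  have cb: "(c * b)\<^sup>2 \<le> \<epsilon>"
    using small[OF b_small] by (simp add: power_mult_distrib)
  then have cb': "c * b \<le> sqrt \<epsilon>"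
    by (rule real_le_rsqrt)
  have "cmod (char (distr M borel (\<lambda>\<omega>. \<Sum>i\<in>I. c * Y i \<omega>)) t - exp (- (t\<^sup>2 * (c\<^sup>2 * s2) / 2)))
      \<le> c\<^sup>2 * s2 * (\<bar>t\<bar> ^ 3 * (c * b) / 6 + t ^ 4 * (c * b)\<^sup>2 / 8)"
    unfolding cY[symmetric]
  proof (rule char_sum_centred_bounded_approx[OF _ _ _ fin])
    show "indep_vars (\<lambda>_. borel) (\<lambda>i \<omega>. c * Y i \<omega>) I"
      by (rule indep_vars_compose2[OF indep]) measurable
    show "\<bar>c * Y i \<omega>\<bar> \<le> c * b" if "i \<in> I" for i \<omega>
      unfolding abs_mult using c0 b[OF that] by simp
    show "expectation (\<lambda>\<omega>. c * Y i \<omega>) = 0" if "i \<in> I" for i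
      using mean[OF that] by simp
  qed
  also have "\<dots> \<le> c\<^sup>2 * s2 * (\<bar>t\<bar> ^ 3 * sqrt \<epsilon> / 6 + t ^ 4 * \<epsilon> / 8)"
    using cb cb' \<tau> by (intro mult_left_mono add_mono divide_right_mono) auto
  also have "\<dots> \<le> 1 * (\<bar>t\<bar> ^ 3 * sqrt \<epsilon> / 6 + t ^ 4 * \<epsilon> / 8)"
    using \<tau> \<epsilon> by (intro mult_right_mono) auto
  finally have 2: "cmod (char (distr M borel (\<lambda>\<omega>. c * H \<omega>)) t - exp (- (t\<^sup>2 * (c\<^sup>2 * s2) / 2)))
      \<le> \<bar>t\<bar> ^ 3 * sqrt \<epsilon> / 6 + t ^ 4 * \<epsilon> / 8"
    by (simp add: H_def sum_distrib_left)
  have "\<bar>exp (- (t\<^sup>2 * (c\<^sup>2 * s2) / 2)) - exp (- (t\<^sup>2 / 2))\<bar> \<le> t\<^sup>2 / 2 - t\<^sup>2 * (c\<^sup>2 * s2) / 2"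
    using \<tau> by (intro abs_exp_minus_diff_le) (auto intro: mult_left_le)
  also have "\<dots> = t\<^sup>2 / 2 * (c\<^sup>2 * q)"
    unfolding \<tau>(3)[symmetric] by (simp add: algebra_simps)
  also have "\<dots> \<le> t\<^sup>2 / 2 * \<epsilon>"
    using small[of q] R_small by (intro mult_left_mono) (auto simp: q_def)
  finally have 3: "cmod (complex_of_real (exp (- (t\<^sup>2 * (c\<^sup>2 * s2) / 2))) - complex_of_real (exp (- (t\<^sup>2) / 2)))
      \<le> t\<^sup>2 / 2 * \<epsilon>"
    unfolding of_real_diff[symmetric] norm_of_real by simp
  let ?a = "char (distr M borel (standardized M U)) t" and ?b = "char (distr M borel (\<lambda>\<omega>. c * H \<omega>)) t"
    and ?c = "complex_of_real (exp (- (t\<^sup>2 * (c\<^sup>2 * s2) / 2)))" and ?d = "complex_of_real (exp (- (t\<^sup>2) / 2))"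
  have "cmod (?a - ?d) \<le> cmod (?a - ?b) + cmod (?b - ?c) + cmod (?c - ?d)"
    using norm_triangle_ineq[of "?a - ?b" "?b - ?c"] norm_triangle_ineq[of "?a - ?c" "?c - ?d"] by simp
  also have "\<dots> \<le> \<bar>t\<bar> * sqrt \<epsilon> + (\<bar>t\<bar> ^ 3 * sqrt \<epsilon> / 6 + t ^ 4 * \<epsilon> / 8) + t\<^sup>2 / 2 * \<epsilon>"
    using 1 2 3 by (intro add_mono) (auto simp: exp_of_real)
  also have "\<dots> = (\<bar>t\<bar> + \<bar>t\<bar> ^ 3 / 6) * sqrt \<epsilon> + (t ^ 4 / 8 + t\<^sup>2 / 2) * \<epsilon>"
    by (simp add: algebra_simps)
  finally show ?thesis by simp
qed

section \<open>The Hoeffding decomposition of a weighted discordance count\<close>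

text \<open>
  One row of the triangular array. A law that is absolutely continuous has no atoms, and the
  absence of atoms excludes ties.
\<close>

locale independent_row = prob_space M for M :: "'a measure" +
  fixes X :: "nat \<Rightarrow> 'a \<Rightarrow> real" and n :: nat
  assumes indep: "indep_vars (\<lambda>_. borel) X {1..n}"
    and no_atoms: "i \<in> {1..n} \<Longrightarrow> prob {\<omega> \<in> space M. X i \<omega> = x} = 0"
begin

definition upper_tail :: "nat \<Rightarrow> real \<Rightarrow> real" where
  "upper_tail i y = prob {\<omega> \<in> space M. X i \<omega> > y}"

definition disc_prob :: "nat \<Rightarrow> nat \<Rightarrow> real" where
  "disc_prob j i = prob {\<omega> \<in> space M. X j \<omega> > X i \<omega>}"

definition cond_excess :: "nat \<Rightarrow> nat \<Rightarrow> real \<Rightarrow> real" where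
  "cond_excess i j y = upper_tail j y - disc_prob j i"

text \<open>
  The part of \<open>1(x > y)\<close> that remains after its mean and its two conditional expectations given
  one variable have been removed. The projection onto \<open>X j\<close> is \<open>1 - upper_tail i x\<close>, as there are
  no ties.
\<close>

definition degenerate :: "nat \<Rightarrow> nat \<Rightarrow> real \<Rightarrow> real \<Rightarrow> real" where
  "degenerate j i x y = of_bool (x > y) - upper_tail j y + upper_tail i x - 1 + disc_prob j i"

text \<open>
  The \<open>i\<close>-th term of the Hajek projection: the index \<open>i\<close> is the later one in the pairs with
  \<open>j < i\<close> and the earlier one in the pairs with \<open>j > i\<close>. In the latter the conditional
  probability is that of the complementary event, which accounts for the minus sign, and the
  weight belongs to the later index \<open>j\<close>.
\<close>

definition projection :: "(nat \<Rightarrow> real) \<Rightarrow> nat \<Rightarrow> real \<Rightarrow> real" where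
  "projection v i y = v i * (\<Sum>j\<in>{1..<i}. cond_excess i j y) - (\<Sum>j\<in>{i<..n}. v j * cond_excess i j y)"

definition remainder :: "(nat \<Rightarrow> real) \<Rightarrow> 'a \<Rightarrow> real" where
  "remainder v \<omega> = (\<Sum>i\<in>{1..n}. \<Sum>j\<in>{1..<i}. v i * degenerate j i (X j \<omega>) (X i \<omega>))"

lemma X_measurable [measurable]: "i \<in> {1..n} \<Longrightarrow> X i \<in> borel_measurable M"
  using indep by (auto simp: indep_vars_def)

lemma expectation_of_bool: "expectation (\<lambda>\<omega>. of_bool (Q \<omega>)) = prob {\<omega> \<in> space M. Q \<omega>}"
proof -
  have "expectation (\<lambda>\<omega>. of_bool (Q \<omega>)) = expectation (indicator {\<omega>. Q \<omega>})"
    by (intro Bochner_Integration.integral_cong) (auto simp: indicator_def)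
  also have "\<dots> = prob {\<omega> \<in> space M. Q \<omega>}"
    by (simp add: Int_def conj_commute)
  finally show ?thesis .
qed

lemma upper_tail_bounds: "0 \<le> upper_tail i y" "upper_tail i y \<le> 1"
  by (auto simp: upper_tail_def)

lemma disc_prob_bounds: "0 \<le> disc_prob j i" "disc_prob j i \<le> 1"
  by (auto simp: disc_prob_def)

lemma upper_tail_measurable [measurable]:
  assumes i: "i \<in> {1..n}"
  shows "upper_tail i \<in> borel_measurable borel"
proof -
  have "mono (\<lambda>y. - upper_tail i y)"
  proof
    fix x y :: real assume "x \<le> y"
    then have "upper_tail i y \<le> upper_tail i x"
      unfolding upper_tail_def using i by (intro finite_measure_mono) auto
    then show "- upper_tail i x \<le> - upper_tail i y" by simp
  qed
  then have "(\<lambda>y. - upper_tail i y) \<in> borel_measurable borel" by (rule borel_measurable_mono)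
  then have "(\<lambda>y. - (- upper_tail i y)) \<in> borel_measurable borel" by measurable
  then show ?thesis by simp
qed

lemma expectation_greater: "expectation (\<lambda>\<omega>. of_bool (X i \<omega> > y)) = upper_tail i y"
  by (simp add: expectation_of_bool upper_tail_def)

text \<open>
  Without atoms the events \<open>X i < x\<close> and \<open>X i > x\<close> are complementary up to a null set.
\<close>

lemma expectation_less:
  assumes i: "i \<in> {1..n}"
  shows "expectation (\<lambda>\<omega>. of_bool (x > X i \<omega>)) = 1 - upper_tail i x"
proof -
  let ?A = "{\<omega> \<in> space M. X i \<omega> < x}" and ?B = "{\<omega> \<in> space M. X i \<omega> = x}"
    and ?C = "{\<omega> \<in> space M. X i \<omega> > x}"
  have [measurable]: "?A \<in> events" "?B \<in> events" "?C \<in> events" using i by measurable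
  have "1 = prob (?A \<union> ?B \<union> ?C)"
    by (subst prob_space[symmetric], rule arg_cong[where f = prob]) auto
  also have "\<dots> = prob ?A + prob ?B + prob ?C"
    by (subst finite_measure_Union, auto)+
  finally show ?thesis
    using no_atoms[OF i, of x] by (simp add: expectation_of_bool upper_tail_def)
qed

lemma expectation_pair_eq_0:
  fixes r g :: "real \<Rightarrow> real \<Rightarrow> real"
  assumes "i \<in> {1..n}" "j \<in> {1..n}" "k \<in> {1..n}" "l \<in> {1..n}" "i \<notin> {j, k, l}"
    and "case_prod r \<in> borel_measurable (borel \<Otimes>\<^sub>M borel)"
    and "case_prod g \<in> borel_measurable (borel \<Otimes>\<^sub>M borel)"
    and "\<And>x y. \<bar>r x y\<bar> \<le> C" "\<And>x y. \<bar>g x y\<bar> \<le> D"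
    and "\<And>x. expectation (\<lambda>\<omega>. r x (X i \<omega>)) = 0"
  shows "expectation (\<lambda>\<omega>. r (X j \<omega>) (X i \<omega>) * g (X k \<omega>) (X l \<omega>)) = 0"
  using assms by (rule expectation_mult_eq_0_if_section_eq_0[OF indep])

lemma integrable_of_bool:
  "Measurable.pred M Q \<Longrightarrow> integrable M (\<lambda>\<omega>. of_bool (Q \<omega>) :: real)"
  by (rule integrable_bounded[where C = 1]) auto

lemma integrable_upper_tail:
  "i \<in> {1..n} \<Longrightarrow> Y \<in> borel_measurable M \<Longrightarrow> integrable M (\<lambda>\<omega>. upper_tail i (Y \<omega>))"
  by (rule integrable_bounded[where C = 1])
    (auto simp: upper_tail_bounds abs_le_iff intro: order_trans[OF _ upper_tail_bounds(1)])

text \<open>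
  Over all Borel sets \<open>B\<close>, these equations are the defining property of the conditional
  probability of \<open>X j > X i\<close> given \<open>X i\<close>.
\<close>

lemma cond_upper_tail:
  assumes ij: "i \<in> {1..n}" "j \<in> {1..n}" "i \<noteq> j" and B [measurable]: "B \<in> sets borel"
  shows "expectation (\<lambda>\<omega>. indicator B (X i \<omega>) * of_bool (X j \<omega> > X i \<omega>))
    = expectation (\<lambda>\<omega>. indicator B (X i \<omega>) * upper_tail j (X i \<omega>))"
proof -
  note [measurable] = ij(1,2)
  have bd: "\<bar>indicator B x * (of_bool (y > x) - upper_tail j x)\<bar> \<le> (1::real)" for x y
    using upper_tail_bounds[of j x] by (auto simp: abs_le_iff indicator_def)
  have "expectation (\<lambda>\<omega>. indicator B (X i \<omega>) * (of_bool (X j \<omega> > X i \<omega>) - upper_tail j (X i \<omega>))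
      * (\<lambda>_ _. 1 :: real) (X i \<omega>) (X i \<omega>)) = 0"
  proof (rule expectation_pair_eq_0[where r = "\<lambda>x y. indicator B x * (of_bool (y > x) - upper_tail j x)" and C = 1 and D = 1])
    show "expectation (\<lambda>\<omega>. indicator B x * (of_bool (X j \<omega> > x) - upper_tail j x)) = 0" for x
      using integrable_of_bool[of "\<lambda>\<omega>. X j \<omega> > x"] ij
      by (simp add: expectation_greater prob_space)
    show "case_prod (\<lambda>x y. indicator B x * (of_bool (y > x) - upper_tail j x) :: real)
        \<in> borel_measurable (borel \<Otimes>\<^sub>M borel)"
      using ij by measurable
  qed (use ij bd in auto)
  moreover have "integrable M (\<lambda>\<omega>. indicator B (X i \<omega>) * of_bool (X j \<omega> > X i \<omega>) :: real)"
    by (rule integrable_bounded[where C = 1]) (use ij in \<open>auto simp: indicator_def\<close>)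
  moreover have "integrable M (\<lambda>\<omega>. indicator B (X i \<omega>) * upper_tail j (X i \<omega>) :: real)"
    by (rule integrable_bounded[where C = 1])
      (use ij upper_tail_bounds in \<open>auto simp: indicator_def abs_le_iff intro: order_trans[OF _ upper_tail_bounds(1)]\<close>)
  ultimately show ?thesis by (simp add: right_diff_distrib)
qed

lemma expectation_upper_tail:
  assumes "i \<in> {1..n}" "j \<in> {1..n}" "i \<noteq> j"
  shows "expectation (\<lambda>\<omega>. upper_tail j (X i \<omega>)) = disc_prob j i"
  using cond_upper_tail[OF assms, of UNIV] by (simp add: expectation_of_bool disc_prob_def)

lemma disc_prob_add_disc_prob:
  assumes ij: "i \<in> {1..n}" "j \<in> {1..n}" "i \<noteq> j"
  shows "disc_prob i j + disc_prob j i = 1"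
proof -
  note [measurable] = ij(1,2)
  have "expectation (\<lambda>\<omega>. of_bool (X i \<omega> = X j \<omega>) * (\<lambda>_ _. 1 :: real) (X j \<omega>) (X j \<omega>)) = 0"
  proof (rule expectation_pair_eq_0[where r = "\<lambda>x y. of_bool (y = x)" and C = 1 and D = 1])
    show "expectation (\<lambda>\<omega>. of_bool (X i \<omega> = x)) = (0::real)" for x
      using no_atoms[OF ij(1)] by (simp add: expectation_of_bool)
  qed (use ij in auto)
  then have eq: "prob {\<omega> \<in> space M. X i \<omega> = X j \<omega>} = 0"
    by (simp add: expectation_of_bool)
  let ?A = "{\<omega> \<in> space M. X i \<omega> > X j \<omega>}" and ?B = "{\<omega> \<in> space M. X i \<omega> = X j \<omega>}"
    and ?C = "{\<omega> \<in> space M. X j \<omega> > X i \<omega>}"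
  have [measurable]: "?A \<in> events" "?B \<in> events" "?C \<in> events" using ij by measurable
  have "1 = prob (?A \<union> ?B \<union> ?C)"
    by (subst prob_space[symmetric], rule arg_cong[where f = prob]) auto
  also have "\<dots> = prob ?A + prob ?B + prob ?C"
    by (subst finite_measure_Union, auto)+
  finally show ?thesis using eq by (simp add: disc_prob_def)
qed

lemma excess_eq_cond_excess:
  assumes ij: "i \<in> {1..n}" "j \<in> {1..n}" "i \<noteq> j"
  shows "AE \<omega> in M. excess M X i j \<omega> = cond_excess i j (X i \<omega>)"
proof -
  note [measurable] = ij(1,2)
  let ?F = "vimage_algebra (space M) (X i) borel"
  let ?A = "{\<omega> \<in> space M. X j \<omega> > X i \<omega>}"
  have "subalgebra M ?F"
    using ij by (auto simp: subalgebra_def sets_vimage_algebra2 intro: measurable_sets[OF X_measurable])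
  then interpret F: finite_measure_subalgebra M ?F
    by unfold_locales
  have A [measurable]: "?A \<in> events" using ij by measurable
  have "AE \<omega> in M. real_cond_exp M ?F (indicator ?A) \<omega> = upper_tail j (X i \<omega>)"
  proof (rule F.real_cond_exp_charact)
    fix E assume "E \<in> sets ?F"
    then obtain B where B [measurable]: "B \<in> sets borel" and E: "E = X i -` B \<inter> space M"
      by (auto simp: sets_vimage_algebra2)
    have "(\<integral>\<omega>\<in>E. indicator ?A \<omega> \<partial>M) = expectation (\<lambda>\<omega>. indicator B (X i \<omega>) * of_bool (X j \<omega> > X i \<omega>) :: real)"
      unfolding set_lebesgue_integral_def
      by (rule Bochner_Integration.integral_cong) (auto simp: E indicator_def)
    also have "\<dots> = expectation (\<lambda>\<omega>. indicator B (X i \<omega>) * upper_tail j (X i \<omega>))"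
      by (rule cond_upper_tail[OF ij B])
    also have "\<dots> = (\<integral>\<omega>\<in>E. upper_tail j (X i \<omega>) \<partial>M)"
      unfolding set_lebesgue_integral_def
      by (rule Bochner_Integration.integral_cong) (auto simp: E indicator_def)
    finally show "(\<integral>\<omega>\<in>E. indicator ?A \<omega> \<partial>M) = (\<integral>\<omega>\<in>E. upper_tail j (X i \<omega>) \<partial>M)" .
  next
    show "integrable M (indicator ?A :: 'a \<Rightarrow> real)"
      by (rule integrable_bounded[where C = 1]) (auto simp: indicator_def)
    show "integrable M (\<lambda>\<omega>. upper_tail j (X i \<omega>))" using ij by (intro integrable_upper_tail) auto
    have "X i \<in> measurable ?F borel"
      by (rule measurable_vimage_algebra1) auto
    then show "(\<lambda>\<omega>. upper_tail j (X i \<omega>)) \<in> borel_measurable ?F"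
      using upper_tail_measurable[OF ij(2)] by (rule measurable_compose)
  qed
  then show ?thesis
    by eventually_elim (simp add: excess_def cond_prob_given_def cond_excess_def disc_prob_def)
qed

lemma excess_measurable:
  assumes ij: "i \<in> {1..n}" "j \<in> {1..n}"
  shows "excess M X i j \<in> borel_measurable M"
  unfolding excess_def cond_prob_given_def by measurable

lemma cond_excess_abs_le: "\<bar>cond_excess i j y\<bar> \<le> 1"
  using upper_tail_bounds[of j y] disc_prob_bounds[of j i] by (auto simp: cond_excess_def abs_le_iff)

lemma cond_excess_measurable [measurable]: "j \<in> {1..n} \<Longrightarrow> cond_excess i j \<in> borel_measurable borel"
  unfolding cond_excess_def by measurable

lemma degenerate_abs_le: "\<bar>degenerate j i x y\<bar> \<le> 2"
  using upper_tail_bounds[of j y] upper_tail_bounds[of i x] disc_prob_bounds[of j i] by (auto simp: degenerate_def abs_le_iff)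

lemma degenerate_measurable:
  "i \<in> {1..n} \<Longrightarrow> j \<in> {1..n} \<Longrightarrow> case_prod (degenerate j i) \<in> borel_measurable (borel \<Otimes>\<^sub>M borel)"
  unfolding degenerate_def by measurable

lemma degenerate_measurable_swap:
  assumes "i \<in> {1..n}" "j \<in> {1..n}"
  shows "(\<lambda>(x, y). degenerate j i y x) \<in> borel_measurable (borel \<Otimes>\<^sub>M borel)"
  using assms unfolding degenerate_def by measurable

lemma degenerate_measurable_X [measurable]:
  assumes "i \<in> {1..n}" "j \<in> {1..n}"
  shows "(\<lambda>\<omega>. degenerate j i (X j \<omega>) (X i \<omega>)) \<in> borel_measurable M"
  using assms unfolding degenerate_def by measurable

lemma degenerate_section_eq_0:
  assumes ij: "i \<in> {1..n}" "j \<in> {1..n}" "i \<noteq> j"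
  shows "expectation (\<lambda>\<omega>. degenerate j i x (X i \<omega>)) = 0" "expectation (\<lambda>\<omega>. degenerate j i (X j \<omega>) y) = 0"
proof -
  note [measurable] = ij(1,2)
  have "integrable M (\<lambda>\<omega>. of_bool (x > X i \<omega>) :: real)" "integrable M (\<lambda>\<omega>. upper_tail j (X i \<omega>))"
    using ij by (auto intro!: integrable_of_bool integrable_upper_tail)
  then show "expectation (\<lambda>\<omega>. degenerate j i x (X i \<omega>)) = 0"
    using ij by (simp add: degenerate_def expectation_less expectation_upper_tail prob_space)
  have "integrable M (\<lambda>\<omega>. of_bool (X j \<omega> > y) :: real)" "integrable M (\<lambda>\<omega>. upper_tail i (X j \<omega>))"
    using ij by (auto intro!: integrable_of_bool integrable_upper_tail)
  then show "expectation (\<lambda>\<omega>. degenerate j i (X j \<omega>) y) = 0"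
    using ij disc_prob_add_disc_prob[OF ij] by (simp add: degenerate_def expectation_greater expectation_upper_tail prob_space)
qed

text \<open>
  One of the two variables of the kernel does not occur in \<open>g\<close>, and integrating it out gives
  zero.
\<close>

lemma degenerate_orthogonal:
  fixes g :: "real \<Rightarrow> real \<Rightarrow> real"
  assumes ij: "i \<in> {1..n}" "j \<in> {1..n}" "i \<noteq> j" and kl: "k \<in> {1..n}" "l \<in> {1..n}"
    and new: "\<not> {i, j} \<subseteq> {k, l}"
    and g: "case_prod g \<in> borel_measurable (borel \<Otimes>\<^sub>M borel)" "\<And>x y. \<bar>g x y\<bar> \<le> D"
  shows "expectation (\<lambda>\<omega>. degenerate j i (X j \<omega>) (X i \<omega>) * g (X k \<omega>) (X l \<omega>)) = 0"
proof (cases "i \<in> {k, l}")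
  case False
  then show ?thesis
    using ij kl by (intro expectation_pair_eq_0[OF _ _ _ _ _ _ g(1) degenerate_abs_le g(2)])
      (auto simp: degenerate_section_eq_0 intro: degenerate_measurable)
next
  case True
  with new have "j \<notin> {i, k, l}" using ij by auto
  then show ?thesis
    using ij kl by (intro expectation_pair_eq_0[where r = "\<lambda>x y. degenerate j i y x", OF _ _ _ _ _ _ g(1) degenerate_abs_le g(2)])
      (auto simp: degenerate_section_eq_0 intro: degenerate_measurable_swap)
qed

text \<open>
  For a single pair the decomposition is the identity
  \<open>1(X\<^sub>j > X\<^sub>i) = P(X\<^sub>j > X\<^sub>i) + e\<^sub>i\<^sub>j(X\<^sub>i) - e\<^sub>j\<^sub>i(X\<^sub>j) + r\<close> with \<open>e = cond_excess\<close> and \<open>r = degenerate j i\<close>,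
  a restatement of the definitions once \<open>P(X\<^sub>i > X\<^sub>j) = 1 - P(X\<^sub>j > X\<^sub>i)\<close>. Exchanging the order of
  summation over the terms \<open>e\<^sub>j\<^sub>i(X\<^sub>j)\<close> then collects everything that involves the same variable.
\<close>

lemma hoeffding_decomposition:
  shows "(\<Sum>i\<in>{1..n}. \<Sum>j\<in>{1..<i}. v i * of_bool (X j \<omega> > X i \<omega>))
    = (\<Sum>i\<in>{1..n}. \<Sum>j\<in>{1..<i}. v i * disc_prob j i) + (\<Sum>i\<in>{1..n}. projection v i (X i \<omega>)) + remainder v \<omega>"
proof -
  have swap: "(\<Sum>i\<in>{1..n}. \<Sum>j\<in>{1..<i}. f i j) = (\<Sum>j\<in>{1..n}. \<Sum>i\<in>{j<..n}. f i j)"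
    for f :: "nat \<Rightarrow> nat \<Rightarrow> real"
  proof -
    have "(\<Sum>i\<in>{1..n}. \<Sum>j\<in>{1..<i}. f i j) = (\<Sum>i\<in>{1..n}. \<Sum>j\<in>{j \<in> {1..n}. j < i}. f i j)"
      by (intro sum.cong refl) auto
    also have "\<dots> = (\<Sum>j\<in>{1..n}. \<Sum>i\<in>{i \<in> {1..n}. j < i}. f i j)"
      by (rule sum.swap_restrict) auto
    also have "\<dots> = (\<Sum>j\<in>{1..n}. \<Sum>i\<in>{j<..n}. f i j)"
      by (intro sum.cong refl) auto
    finally show ?thesis .
  qed
  have expand: "v i * of_bool (X j \<omega> > X i \<omega>) = v i * disc_prob j i + v i * cond_excess i j (X i \<omega>)
      - v i * cond_excess j i (X j \<omega>) + v i * degenerate j i (X j \<omega>) (X i \<omega>)"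
    if "i \<in> {1..n}" "j \<in> {1..<i}" for i j
  proof -
    have e: "disc_prob i j = 1 - disc_prob j i" using disc_prob_add_disc_prob[of i j] that by simp
    show ?thesis unfolding cond_excess_def degenerate_def e by (simp add: algebra_simps)
  qed
  have "(\<Sum>i\<in>{1..n}. \<Sum>j\<in>{1..<i}. v i * of_bool (X j \<omega> > X i \<omega>))
    = (\<Sum>i\<in>{1..n}. \<Sum>j\<in>{1..<i}. v i * disc_prob j i + v i * cond_excess i j (X i \<omega>)
      - v i * cond_excess j i (X j \<omega>) + v i * degenerate j i (X j \<omega>) (X i \<omega>))"
    by (intro sum.cong refl expand)
  also have "\<dots> = (\<Sum>i\<in>{1..n}. \<Sum>j\<in>{1..<i}. v i * disc_prob j i)
      + ((\<Sum>i\<in>{1..n}. \<Sum>j\<in>{1..<i}. v i * cond_excess i j (X i \<omega>))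
        - (\<Sum>i\<in>{1..n}. \<Sum>j\<in>{1..<i}. v i * cond_excess j i (X j \<omega>))) + remainder v \<omega>"
    by (simp add: sum.distrib sum_subtractf remainder_def)
  also have "(\<Sum>i\<in>{1..n}. \<Sum>j\<in>{1..<i}. v i * cond_excess j i (X j \<omega>))
      = (\<Sum>j\<in>{1..n}. \<Sum>i\<in>{j<..n}. v i * cond_excess j i (X j \<omega>))"
    by (rule swap)
  also have "(\<Sum>i\<in>{1..n}. \<Sum>j\<in>{1..<i}. v i * cond_excess i j (X i \<omega>)) - \<dots> = (\<Sum>i\<in>{1..n}. projection v i (X i \<omega>))"
    by (simp add: projection_def sum_subtractf sum_distrib_left)
  finally show ?thesis .
qed

lemma projection_measurable [measurable]: "i \<in> {1..n} \<Longrightarrow> projection v i \<in> borel_measurable borel"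
  unfolding projection_def by (intro borel_measurable_diff borel_measurable_times borel_measurable_sum) auto

lemma projection_abs_le:
  assumes "\<And>i. 1 \<le> i \<Longrightarrow> 0 \<le> v i" and "1 \<le> i"
  shows "\<bar>projection v i y\<bar> \<le> v i * (real i - 1) + (\<Sum>j\<in>{i<..n}. v j)"
proof -
  have "\<bar>\<Sum>j\<in>{1..<i}. cond_excess i j y\<bar> \<le> (\<Sum>j\<in>{1..<i}. 1)"
    by (intro order_trans[OF sum_abs] sum_mono cond_excess_abs_le)
  then have 1: "\<bar>v i * (\<Sum>j\<in>{1..<i}. cond_excess i j y)\<bar> \<le> v i * (real i - 1)"
    using assms by (auto simp: abs_mult intro!: mult_left_mono)
  have "\<bar>\<Sum>j\<in>{i<..n}. v j * cond_excess i j y\<bar> \<le> (\<Sum>j\<in>{i<..n}. v j)"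
    using assms cond_excess_abs_le by (intro order_trans[OF sum_abs] sum_mono) (auto simp: abs_mult mult_left_le)
  with 1 show ?thesis unfolding projection_def by linarith
qed

lemma expectation_projection:
  assumes i: "i \<in> {1..n}"
  shows "expectation (\<lambda>\<omega>. projection v i (X i \<omega>)) = 0"
proof -
  have int: "integrable M (\<lambda>\<omega>. cond_excess i j (X i \<omega>))" if "j \<in> {1..n}" for j
    by (rule integrable_bounded[OF _ cond_excess_abs_le]) (use i that in measurable)
  have zero: "expectation (\<lambda>\<omega>. cond_excess i j (X i \<omega>)) = 0" if "j \<in> {1..n}" "j \<noteq> i" for j
    using i that integrable_upper_tail[of j "X i"] by (simp add: cond_excess_def expectation_upper_tail prob_space)
  have "expectation (\<lambda>\<omega>. projection v i (X i \<omega>)) = v i * (\<Sum>j\<in>{1..<i}. expectation (\<lambda>\<omega>. cond_excess i j (X i \<omega>)))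
      - (\<Sum>j\<in>{i<..n}. v j * expectation (\<lambda>\<omega>. cond_excess i j (X i \<omega>)))"
    unfolding projection_def using i int by (subst Bochner_Integration.integral_diff) auto
  also have "\<dots> = 0"
    using i zero by simp
  finally show ?thesis .
qed

text \<open>
  On the event provided by the hypothesis, every term with \<open>j < i\<close> has the same sign and size at
  least \<open>d\<close>, and every term with \<open>j > i\<close> has size at most one. Hence the projection is at least
  \<open>\<kappa>\<close> in absolute value there.
\<close>

lemma second_moment_projection_ge:
  assumes i: "i \<in> {1..n}" and v: "\<And>i. 1 \<le> i \<Longrightarrow> 0 \<le> v i"
    and margin: "0 \<le> \<kappa>" "\<kappa> \<le> d * (v i * (real i - 1)) - (\<Sum>j\<in>{i<..n}. v j)"
    and pos: "q \<le> prob {\<omega> \<in> space M. \<forall>j\<in>{1..n} - {i}. excess M X i j \<omega> \<in> {d..1}}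
        \<or> q \<le> prob {\<omega> \<in> space M. \<forall>j\<in>{1..n} - {i}. excess M X i j \<omega> \<in> {-1..- d}}"
  shows "\<kappa>\<^sup>2 * q \<le> expectation (\<lambda>\<omega>. (projection v i (X i \<omega>))\<^sup>2)"
proof -
  \<comment> \<open>The sign \<open>s\<close> merges the two alternatives of the hypothesis.\<close>
  obtain s :: real where s: "s = 1 \<or> s = -1"
    and q: "q \<le> prob {\<omega> \<in> space M. \<forall>j\<in>{1..n} - {i}. s * excess M X i j \<omega> \<in> {d..1}}"
  proof -
    have "(- x \<in> {d..1}) = (x \<in> {-1..- d})" for x :: real by auto
    then show ?thesis using pos that[of 1] that[of "-1"] by (auto simp del: atLeastAtMost_iff)
  qed
  let ?E = "{\<omega> \<in> space M. \<forall>j\<in>{1..n} - {i}. s * excess M X i j \<omega> \<in> {d..1}}"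
  have E: "?E \<in> events"
    using excess_measurable[OF i] by (intro sets.sets_Collect_finite_All) auto
  have ae: "AE \<omega> in M. \<forall>j\<in>{1..n} - {i}. excess M X i j \<omega> = cond_excess i j (X i \<omega>)"
    using excess_eq_cond_excess[OF i] by (intro AE_finite_allI) auto
  have large: "\<kappa> \<le> s * projection v i y" if "\<forall>j\<in>{1..n} - {i}. s * cond_excess i j y \<in> {d..1}" for y
  proof -
    have "d * (v i * (real i - 1)) = v i * (\<Sum>j\<in>{1..<i}. d)"
      using i by simp
    also have "\<dots> \<le> v i * (\<Sum>j\<in>{1..<i}. s * cond_excess i j y)"
      using that i v by (intro mult_left_mono sum_mono) auto
    finally have 1: "d * (v i * (real i - 1)) \<le> v i * (\<Sum>j\<in>{1..<i}. s * cond_excess i j y)" .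
    have "(\<Sum>j\<in>{i<..n}. v j * (s * cond_excess i j y)) \<le> (\<Sum>j\<in>{i<..n}. v j * 1)"
      using that i v by (intro sum_mono mult_left_mono) auto
    with 1 margin have "\<kappa> \<le> v i * (\<Sum>j\<in>{1..<i}. s * cond_excess i j y) - (\<Sum>j\<in>{i<..n}. v j * (s * cond_excess i j y))"
      by simp
    also have "\<dots> = s * projection v i y"
      by (simp add: projection_def right_diff_distrib sum_distrib_left mult.left_commute)
    finally show ?thesis .
  qed
  have "\<kappa>\<^sup>2 * q \<le> \<kappa>\<^sup>2 * prob ?E"
    by (intro mult_left_mono q) simp
  also have "\<dots> = expectation (\<lambda>\<omega>. \<kappa>\<^sup>2 * indicator ?E \<omega>)"
    using E by simp
  also have "\<dots> \<le> expectation (\<lambda>\<omega>. (projection v i (X i \<omega>))\<^sup>2)"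
  proof (rule integral_mono_AE)
    show "integrable M (\<lambda>\<omega>. \<kappa>\<^sup>2 * indicator ?E \<omega> :: real)"
      using E by (intro integrable_bounded[where C = "\<kappa>\<^sup>2"]) (auto simp: indicator_def)
    have "\<bar>(projection v i y)\<^sup>2\<bar> \<le> (v i * (real i - 1) + (\<Sum>j\<in>{i<..n}. v j))\<^sup>2" for y
      using power_mono[OF projection_abs_le[where v = v and i = i and y = y, OF v], of 2] i by simp
    then show "integrable M (\<lambda>\<omega>. (projection v i (X i \<omega>))\<^sup>2)"
      by (rule integrable_bounded[rotated]) (use i in measurable)
    show "AE \<omega> in M. \<kappa>\<^sup>2 * indicator ?E \<omega> \<le> (projection v i (X i \<omega>))\<^sup>2"
      using ae
    proof eventually_elim
      case (elim \<omega>)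
      show ?case
      proof (cases "\<omega> \<in> ?E")
        case True
        then have "\<kappa> \<le> s * projection v i (X i \<omega>)" using elim by (intro large) auto
        then have "\<kappa>\<^sup>2 \<le> (s * projection v i (X i \<omega>))\<^sup>2" using margin(1) by (rule power_mono)
        with s True show ?thesis by (auto simp: power_mult_distrib)
      qed simp
    qed
  qed
  finally show ?thesis .
qed

lemma remainder_measurable [measurable]: "remainder v \<in> borel_measurable M"
  unfolding remainder_def[abs_def] by (intro borel_measurable_sum borel_measurable_times) auto

lemma remainder_abs_le: "\<bar>remainder v \<omega>\<bar> \<le> (\<Sum>i\<in>{1..n}. \<Sum>j\<in>{1..<i}. \<bar>v i\<bar> * 2)"
  unfolding remainder_def
  by (intro order_trans[OF sum_abs] sum_mono) (auto simp: abs_mult intro!: mult_left_mono degenerate_abs_le)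

lemma integrable_degenerate_mult:
  assumes "i \<in> {1..n}" "j \<in> {1..n}" "Y \<in> borel_measurable M" "\<And>\<omega>. \<bar>Y \<omega>\<bar> \<le> C"
  shows "integrable M (\<lambda>\<omega>. degenerate j i (X j \<omega>) (X i \<omega>) * Y \<omega>)"
proof (rule integrable_bounded[where C = "2 * C"])
  show "\<bar>degenerate j i (X j \<omega>) (X i \<omega>) * Y \<omega>\<bar> \<le> 2 * C" for \<omega>
    unfolding abs_mult by (intro mult_mono degenerate_abs_le assms) auto
qed (use assms in measurable)

lemma expectation_mult_remainder:
  assumes k: "k \<in> {1..n}" and g: "g \<in> borel_measurable borel" "\<And>x. \<bar>g x\<bar> \<le> C"
  shows "expectation (\<lambda>\<omega>. g (X k \<omega>) * remainder v \<omega>) = 0"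
proof -
  note [measurable] = g(1) k
  have zero: "expectation (\<lambda>\<omega>. degenerate j i (X j \<omega>) (X i \<omega>) * g (X k \<omega>)) = 0" if "i \<in> {1..n}" "j \<in> {1..<i}" for i j
    by (rule degenerate_orthogonal[where g = "\<lambda>x _. g x" and l = k and D = C]) (use that k g in auto)
  have int: "integrable M (\<lambda>\<omega>. degenerate j i (X j \<omega>) (X i \<omega>) * g (X k \<omega>))" if "i \<in> {1..n}" "j \<in> {1..<i}" for i j
    by (rule integrable_degenerate_mult[where C = C]) (use that k g in auto)
  have "expectation (\<lambda>\<omega>. g (X k \<omega>) * remainder v \<omega>)
      = expectation (\<lambda>\<omega>. \<Sum>i\<in>{1..n}. \<Sum>j\<in>{1..<i}. v i * (degenerate j i (X j \<omega>) (X i \<omega>) * g (X k \<omega>)))"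
    unfolding remainder_def sum_distrib_left by (simp add: ac_simps)
  also have "\<dots> = (\<Sum>i\<in>{1..n}. expectation (\<lambda>\<omega>. \<Sum>j\<in>{1..<i}. v i * (degenerate j i (X j \<omega>) (X i \<omega>) * g (X k \<omega>))))"
    by (intro Bochner_Integration.integral_sum Bochner_Integration.integrable_sum integrable_mult_right int)
  also have "\<dots> = (\<Sum>i\<in>{1..n}. \<Sum>j\<in>{1..<i}. v i * expectation (\<lambda>\<omega>. degenerate j i (X j \<omega>) (X i \<omega>) * g (X k \<omega>)))"
    by (intro sum.cong refl, subst Bochner_Integration.integral_sum) (use int in auto)
  also have "\<dots> = 0" using zero by simp
  finally show ?thesis .
qed

text \<open>
  Two distinct ordered pairs \<open>j < i\<close> and \<open>l < k\<close> are distinct as sets, so their kernels are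
  orthogonal and only the diagonal survives; each kernel is bounded by two.
\<close>

lemma second_moment_remainder_le:
  shows "expectation (\<lambda>\<omega>. (remainder v \<omega>)\<^sup>2) \<le> 4 * (\<Sum>i\<in>{1..n}. (real i - 1) * (v i)\<^sup>2)"
proof -
  define P where "P = (SIGMA i:{1..n}. {1..<i})"
  define f where "f = (\<lambda>(i, j) \<omega>. degenerate j i (X j \<omega>) (X i \<omega>))"
  have fin: "finite P" by (simp add: P_def)
  have remainder: "remainder v \<omega> = (\<Sum>q\<in>P. v (fst q) * f q \<omega>)" for \<omega>
    unfolding remainder_def P_def f_def by (subst sum.Sigma) (auto intro!: sum.cong)
  have fb: "\<bar>f q \<omega>\<bar> \<le> 2" for q \<omega> unfolding f_def by (cases q) (simp add: degenerate_abs_le)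
  have fm: "f q \<in> borel_measurable M" if "q \<in> P" for q
    using that unfolding f_def P_def by auto
  have int: "integrable M (\<lambda>\<omega>. f q \<omega> * f q' \<omega>)" if "q \<in> P" "q' \<in> P" for q q'
    using integrable_degenerate_mult[of "fst q" "snd q" "f q'" 2] fm fb that by (auto simp: f_def P_def)
  have zero: "expectation (\<lambda>\<omega>. f q \<omega> * f q' \<omega>) = 0" if q: "q \<in> P" "q' \<in> P" "q \<noteq> q'" for q q'
  proof -
    obtain i j k l where ij: "q = (i, j)" "q' = (k, l)" by (cases q, cases q') auto
    \<comment> \<open>Here the order \<open>j < i\<close>, \<open>l < k\<close> of the pairs matters.\<close>
    have "\<not> {i, j} \<subseteq> {l, k}" using q by (auto simp: ij P_def)
    then show ?thesis
      unfolding f_def ij using q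
      by (auto simp: ij P_def intro!: degenerate_orthogonal[where g = "degenerate l k" and D = 2] degenerate_measurable degenerate_abs_le)
  qed
  have diag: "expectation (\<lambda>\<omega>. f q \<omega> * f q \<omega>) \<le> 4" if "q \<in> P" for q
  proof -
    have "expectation (\<lambda>\<omega>. f q \<omega> * f q \<omega>) \<le> expectation (\<lambda>_. 4)"
    proof (rule integral_mono[OF int[OF that that]])
      show "f q \<omega> * f q \<omega> \<le> 4" for \<omega>
        using power_mono[OF fb, of q \<omega> 2] by (simp add: power2_eq_square)
    qed simp
    then show ?thesis by (simp add: prob_space)
  qed
  have "expectation (\<lambda>\<omega>. (remainder v \<omega>)\<^sup>2)
      = expectation (\<lambda>\<omega>. \<Sum>q\<in>P. \<Sum>q'\<in>P. v (fst q) * v (fst q') * (f q \<omega> * f q' \<omega>))"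
    unfolding remainder power2_eq_square sum_product by (simp add: ac_simps)
  also have "\<dots> = (\<Sum>q\<in>P. \<Sum>q'\<in>P. v (fst q) * v (fst q') * expectation (\<lambda>\<omega>. f q \<omega> * f q' \<omega>))"
    using int by (simp add: Bochner_Integration.integral_sum)
  also have "\<dots> = (\<Sum>q\<in>P. \<Sum>q'\<in>P. if q = q' then (v (fst q))\<^sup>2 * expectation (\<lambda>\<omega>. f q \<omega> * f q \<omega>) else 0)"
    by (intro sum.cong refl) (auto simp: zero power2_eq_square)
  also have "\<dots> = (\<Sum>q\<in>P. (v (fst q))\<^sup>2 * expectation (\<lambda>\<omega>. f q \<omega> * f q \<omega>))"
    using fin by simp
  also have "\<dots> \<le> (\<Sum>q\<in>P. (v (fst q))\<^sup>2 * 4)"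
    by (intro sum_mono mult_left_mono diag) auto
  also have "\<dots> = (\<Sum>i\<in>{1..n}. \<Sum>j\<in>{1..<i}. (v i)\<^sup>2 * 4)"
    unfolding P_def by (subst sum.Sigma) (auto intro!: sum.cong)
  also have "\<dots> = 4 * (\<Sum>i\<in>{1..n}. (real i - 1) * (v i)\<^sup>2)"
    unfolding sum_distrib_left by (intro sum.cong) auto
  finally show ?thesis .
qed

lemma expectation_remainder:
  assumes "1 \<le> n"
  shows "expectation (remainder v) = 0"
  using expectation_mult_remainder[of n "\<lambda>_. 1" 1 v] assms by simp

text \<open>
  \<open>B\<close> bounds the influence of a single observation on the count. The lower bound
  \<open>n d\<^sup>3 q / 64\<close> for the variance is the product of the number \<open>d n / 4\<close> of indices near the end
  of the row and the second moment \<open>(d / 4)\<^sup>2 q\<close> available for each. The factor \<open>256 = 4 * 64\<close>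
  in \<open>\<epsilon>\<close> leaves room for the bound \<open>4 B\<^sup>2\<close> on the second moment of the remainder.
\<close>

lemma char_weighted_discordance_approx:
  assumes n: "1 \<le> n" and v: "\<And>i. 1 \<le> i \<Longrightarrow> 0 \<le> v i" and d: "0 < d" "d < 1" and q: "0 < q"
    and influence: "\<And>i. i \<in> {1..n} \<Longrightarrow> v i * (real i - 1) + (\<Sum>j\<in>{i<..n}. v j) \<le> B"
    and energy: "(\<Sum>i\<in>{1..n}. (real i - 1) * (v i)\<^sup>2) \<le> B\<^sup>2"
    and margin: "\<And>i. i \<in> {1..n} \<Longrightarrow> 4 * (real n - real i) \<le> d * real n \<Longrightarrow>
        d / 4 \<le> d * (v i * (real i - 1)) - (\<Sum>j\<in>{i<..n}. v j)"
    and pos: "\<And>i. i \<in> {1..n} \<Longrightarrow>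
        q \<le> prob {\<omega> \<in> space M. \<forall>j\<in>{1..n} - {i}. excess M X i j \<omega> \<in> {d..1}}
        \<or> q \<le> prob {\<omega> \<in> space M. \<forall>j\<in>{1..n} - {i}. excess M X i j \<omega> \<in> {-1..- d}}"
  defines "\<epsilon> \<equiv> 256 * (B\<^sup>2 / (real n * (d ^ 3 * q)))"
  shows "cmod (char (distr M borel (standardized M
        (\<lambda>\<omega>. \<Sum>i\<in>{1..n}. \<Sum>j\<in>{1..<i}. v i * of_bool (X j \<omega> > X i \<omega>)))) t - exp (- (t\<^sup>2) / 2))
    \<le> (\<bar>t\<bar> + \<bar>t\<bar> ^ 3 / 6) * sqrt \<epsilon> + (t ^ 4 / 8 + t\<^sup>2 / 2) * \<epsilon>"
proof (rule char_standardized_approx[where I = "{1..n}" and Y = "\<lambda>i \<omega>. projection v i (X i \<omega>)" and b = B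
      and R = "remainder v" and S = "real n * (d ^ 3 * q) / 64" and \<mu> = "\<Sum>i\<in>{1..n}. \<Sum>j\<in>{1..<i}. v i * disc_prob j i"])
  show "indep_vars (\<lambda>_. borel) (\<lambda>i \<omega>. projection v i (X i \<omega>)) {1..n}"
    by (rule indep_vars_compose2[OF indep]) measurable
  have projection_b: "\<bar>projection v i y\<bar> \<le> B" if "i \<in> {1..n}" for i y
    using projection_abs_le[where v = v and i = i and y = y, OF v] influence[OF that] that by simp
  then show "\<bar>projection v i (X i \<omega>)\<bar> \<le> B" if "i \<in> {1..n}" for i \<omega> using that by simp
  show "expectation (\<lambda>\<omega>. projection v i (X i \<omega>)) = 0" if "i \<in> {1..n}" for i
    by (rule expectation_projection[OF that])
  show "expectation (\<lambda>\<omega>. projection v i (X i \<omega>) * remainder v \<omega>) = 0" if "i \<in> {1..n}" for i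
    by (rule expectation_mult_remainder[OF that _ projection_b]) (use that in simp_all)
  show "expectation (remainder v) = 0" by (rule expectation_remainder[OF n])
  show S0: "0 < real n * (d ^ 3 * q) / 64" using n d q by simp
  have \<epsilon>S: "\<epsilon> * (real n * (d ^ 3 * q) / 64) = 4 * B\<^sup>2"
    using n d q by (simp add: \<epsilon>_def)
  show "B\<^sup>2 \<le> \<epsilon> * (real n * (d ^ 3 * q) / 64)" unfolding \<epsilon>S by simp
  show "expectation (\<lambda>\<omega>. (remainder v \<omega>)\<^sup>2) \<le> \<epsilon> * (real n * (d ^ 3 * q) / 64)"
    unfolding \<epsilon>S using second_moment_remainder_le[of v] energy by linarith
  show "real n * (d ^ 3 * q) / 64 \<le> (\<Sum>i\<in>{1..n}. expectation (\<lambda>\<omega>. (projection v i (X i \<omega>))\<^sup>2))"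
  proof -
    \<comment> \<open>The last \<open>m + 1\<close> indices satisfy the margin condition, and \<open>m + 1 \<ge> d n / 4\<close> even when \<open>m = 0\<close>.\<close>
    define m where "m = nat \<lfloor>d * real n / 4\<rfloor>"
    have "real m = of_int \<lfloor>d * real n / 4\<rfloor>"
      using d by (simp add: m_def)
    then have m: "real m \<le> d * real n / 4" "d * real n / 4 \<le> real m + 1"
      by linarith+
    have "d * real n \<le> 1 * real n" using d by (intro mult_right_mono) auto
    then have mn: "m < n" using m(1) n by linarith
    let ?J = "{n - m..n}"
    have "real n * (d ^ 3 * q) / 64 = d * real n / 4 * ((d / 4)\<^sup>2 * q)"
      by (simp add: power2_eq_square power3_eq_cube)
    also have "\<dots> \<le> real (card ?J) * ((d / 4)\<^sup>2 * q)"
      using m mn q by (intro mult_right_mono) auto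
    also have "\<dots> = (\<Sum>i\<in>?J. (d / 4)\<^sup>2 * q)"
      by simp
    also have "\<dots> \<le> (\<Sum>i\<in>?J. expectation (\<lambda>\<omega>. (projection v i (X i \<omega>))\<^sup>2))"
    proof (rule sum_mono)
      fix i assume i: "i \<in> ?J"
      then have i': "i \<in> {1..n}" using mn by auto
      have "4 * (real n - real i) \<le> d * real n" using i m mn by auto
      from margin[OF i' this] show "(d / 4)\<^sup>2 * q \<le> expectation (\<lambda>\<omega>. (projection v i (X i \<omega>))\<^sup>2)"
        using d by (intro second_moment_projection_ge[OF i' v _ _ pos[OF i']]) auto
    qed
    also have "\<dots> \<le> (\<Sum>i\<in>{1..n}. expectation (\<lambda>\<omega>. (projection v i (X i \<omega>))\<^sup>2))"
      using mn by (intro sum_mono2) auto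
    finally show ?thesis .
  qed
  show "\<bar>remainder v \<omega>\<bar> \<le> (\<Sum>i\<in>{1..n}. \<Sum>j\<in>{1..<i}. \<bar>v i\<bar> * 2)" for \<omega>
    by (rule remainder_abs_le)
qed (simp_all only: hoeffding_decomposition remainder_measurable finite_atLeastAtMost)

end

section \<open>The limit theorem for Kendall's and the average-precision weights\<close>

lemma (in prob_space) standardized_cmult:
  assumes c: "0 < c"
  shows "standardized M (\<lambda>\<omega>. c * Y \<omega>) = standardized M Y"
proof
  fix \<omega>
  have "variance (\<lambda>\<omega>. c * Y \<omega>) = expectation (\<lambda>\<omega>. c\<^sup>2 * (Y \<omega> - expectation Y)\<^sup>2)"
    by (rule Bochner_Integration.integral_cong) (auto simp: right_diff_distrib[symmetric] power_mult_distrib)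
  then have "variance (\<lambda>\<omega>. c * Y \<omega>) = c\<^sup>2 * variance Y" by simp
  moreover have "(c\<^sup>2 * variance Y) powr (- 1 / 2) = c\<^sup>2 powr (- 1 / 2) * variance Y powr (- 1 / 2)"
    by (rule powr_mult)
  moreover have "c\<^sup>2 powr (- 1 / 2) = 1 / c"
    using c by (simp add: powr_minus_divide powr_half_sqrt flip: minus_divide_left)
  ultimately show "standardized M (\<lambda>\<omega>. c * Y \<omega>) \<omega> = standardized M Y \<omega>"
    using c by (simp add: standardized_def right_diff_distrib[symmetric])
qed

text \<open>
  The bound for a row becomes a limit theorem as soon as \<open>B\<^sup>2 / (n \<delta>\<^sup>3 p)\<close> tends to zero.
\<close>

lemma weak_conv_weighted_discordance:
  fixes M :: "nat \<Rightarrow> 'a measure"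
    and X :: "nat \<Rightarrow> nat \<Rightarrow> 'a \<Rightarrow> real"
    and \<delta> p B c :: "nat \<Rightarrow> real" and v :: "nat \<Rightarrow> nat \<Rightarrow> real"
    and U :: "nat \<Rightarrow> (nat \<Rightarrow> real) \<Rightarrow> real"
  assumes prob: "\<And>n. n \<ge> 1 \<Longrightarrow> prob_space (M n)"
    and indep: "\<And>n. n \<ge> 1 \<Longrightarrow> prob_space.indep_vars (M n) (\<lambda>_. borel) (X n) {1..n}"
    and abs_cont: "\<And>n i. n \<ge> 1 \<Longrightarrow> i \<in> {1..n} \<Longrightarrow>
          absolutely_continuous lborel (distr (M n) borel (X n i))"
    and delta: "\<And>n. n \<ge> 1 \<Longrightarrow> \<delta> n \<in> {0<..<1}"
    and p: "\<And>n. n \<ge> 1 \<Longrightarrow> p n \<in> {0<..<1}"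
    and cond: "\<forall>\<^sub>F n in sequentially. \<forall>i\<in>{1..n}.
          measure (M n) {\<omega> \<in> space (M n). \<forall>j\<in>{1..n} - {i}.
              excess (M n) (X n) i j \<omega> \<in> {\<delta> n..1}} \<ge> p n
        \<or> measure (M n) {\<omega> \<in> space (M n). \<forall>j\<in>{1..n} - {i}.
              excess (M n) (X n) i j \<omega> \<in> {-1..- \<delta> n}} \<ge> p n"
    and U: "\<forall>\<^sub>F n in sequentially. 0 < c n \<and>
          (\<forall>x. U n x = c n * (\<Sum>i\<in>{1..n}. \<Sum>j\<in>{1..<i}. v n i * of_bool (x j > x i)))"
    and v: "\<And>n i. 1 \<le> i \<Longrightarrow> 0 \<le> v n i"
    and influence: "\<forall>\<^sub>F n in sequentially. \<forall>i\<in>{1..n}.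
          v n i * (real i - 1) + (\<Sum>j\<in>{i<..n}. v n j) \<le> B n"
    and energy: "\<forall>\<^sub>F n in sequentially. (\<Sum>i\<in>{1..n}. (real i - 1) * (v n i)\<^sup>2) \<le> (B n)\<^sup>2"
    and margin: "\<forall>\<^sub>F n in sequentially. \<forall>i\<in>{1..n}. 4 * (real n - real i) \<le> \<delta> n * real n \<longrightarrow>
          \<delta> n / 4 \<le> \<delta> n * (v n i * (real i - 1)) - (\<Sum>j\<in>{i<..n}. v n j)"
    and small: "(\<lambda>n. (B n)\<^sup>2 / (real n * (\<delta> n ^ 3 * p n))) \<longlonglongrightarrow> 0"
  shows "weak_conv_m (\<lambda>n. distr (M n) borel (standardized (M n) (\<lambda>\<omega>. U n (\<lambda>i. X n i \<omega>))))
    std_normal_distribution"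
proof -
  define W where "W n \<omega> = (\<Sum>i\<in>{1..n}. \<Sum>j\<in>{1..<i}. v n i * of_bool (X n j \<omega> > X n i \<omega>))" for n \<omega>
  \<comment> \<open>Levy's theorem requires a probability distribution at every index, so row zero is filled in with the limit.\<close>
  define D where "D n = (if n = 0 then std_normal_distribution else distr (M n) borel (standardized (M n) (W n)))" for n
  have row: "independent_row (M n) (X n) n" if n: "n \<ge> 1" for n
  proof -
    interpret prob_space "M n" by (rule prob[OF n])
    show ?thesis
    proof
      show "indep_vars (\<lambda>_. borel) (X n) {1..n}" by (rule indep[OF n])
      fix i and x :: real assume i: "i \<in> {1..n}"
      have [measurable]: "X n i \<in> borel_measurable (M n)"
        using indep[OF n] i by (auto simp: indep_vars_def)
      have "{x} \<in> null_sets lborel"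
        by (rule finite_imp_null_set_lborel) simp
      then have "{x} \<in> null_sets (distr (M n) borel (X n i))"
        using abs_cont[OF n i] by (auto simp: absolutely_continuous_def)
      then have "emeasure (M n) (X n i -` {x} \<inter> space (M n)) = 0"
        by (simp add: null_sets_def emeasure_distr)
      also have "X n i -` {x} \<inter> space (M n) = {\<omega> \<in> space (M n). X n i \<omega> = x}" by auto
      finally show "prob {\<omega> \<in> space (M n). X n i \<omega> = x} = 0" by (simp add: measure_def)
    qed
  qed
  have D_real: "real_distribution (D n)" for n
  proof (cases "n = 0")
    case True
    then show ?thesis by (simp add: D_def real_dist_normal_dist)
  next
    case False
    then interpret independent_row "M n" "X n" n by (intro row) simp
    have "W n \<in> borel_measurable (M n)"
      unfolding W_def[abs_def] by (intro borel_measurable_sum borel_measurable_times) auto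
    then have "standardized (M n) (W n) \<in> borel_measurable (M n)"
      unfolding standardized_def[abs_def] by measurable
    then show ?thesis using False by (auto simp: D_def intro: real_distribution_distr)
  qed
  have "weak_conv_m D std_normal_distribution"
  proof (rule levy_continuity[OF D_real real_dist_normal_dist])
    fix t
    let ?\<epsilon> = "\<lambda>n. 256 * ((B n)\<^sup>2 / (real n * (\<delta> n ^ 3 * p n)))"
    let ?b = "\<lambda>n. (\<bar>t\<bar> + \<bar>t\<bar> ^ 3 / 6) * sqrt (?\<epsilon> n) + (t ^ 4 / 8 + t\<^sup>2 / 2) * ?\<epsilon> n"
    have "?b \<longlonglongrightarrow> (\<bar>t\<bar> + \<bar>t\<bar> ^ 3 / 6) * sqrt (256 * 0) + (t ^ 4 / 8 + t\<^sup>2 / 2) * (256 * 0)"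
      by (intro tendsto_intros small)
    then have lim: "?b \<longlonglongrightarrow> 0" by simp
    have "\<forall>\<^sub>F n in sequentially. norm (char (D n) t - exp (- (t\<^sup>2) / 2)) \<le> ?b n"
      using cond influence energy margin eventually_ge_at_top[of 1]
    proof eventually_elim
      case (elim n)
      then interpret independent_row "M n" "X n" n by (intro row)
      show ?case
        using char_weighted_discordance_approx[of "v n" "\<delta> n" "p n" "B n" t] elim v delta[of n] p[of n]
        by (simp add: D_def W_def[abs_def])
    qed
    from Lim_null_comparison[OF this lim]
    have "(\<lambda>n. char (D n) t - exp (- (t\<^sup>2) / 2)) \<longlonglongrightarrow> 0" .
    then show "(\<lambda>n. char (D n) t) \<longlonglongrightarrow> char std_normal_distribution t"
      by (simp add: LIM_zero_iff char_std_normal_distribution exp_of_real)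
  qed
  moreover have "\<forall>\<^sub>F n in sequentially. D n = distr (M n) borel (standardized (M n) (\<lambda>\<omega>. U n (\<lambda>i. X n i \<omega>)))"
    using U eventually_ge_at_top[of 1]
  proof eventually_elim
    case (elim n)
    interpret prob_space "M n" using prob elim by simp
    show ?case using elim standardized_cmult[of "c n" "W n"] by (simp add: D_def W_def[abs_def])
  qed
  ultimately show ?thesis
    unfolding weak_conv_m_def weak_conv_def
    by (auto elim!: eventually_mono intro: Lim_transform_eventually)
qed

lemma sum_mult_of_bool_less:
  fixes f :: "nat \<Rightarrow> real"
  assumes "i \<in> {1..n}"
  shows "(\<Sum>j\<in>{1..n} - {i}. of_bool (j < i) * f j) = (\<Sum>j\<in>{1..<i}. f j)"
proof -
  have "(\<Sum>j\<in>{1..n} - {i}. of_bool (j < i) * f j) = (\<Sum>j\<in>{1..<i}. of_bool (j < i) * f j)"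
    using assms by (intro sum.mono_neutral_right) auto
  also have "\<dots> = (\<Sum>j\<in>{1..<i}. f j)" by (intro sum.cong) auto
  finally show ?thesis .
qed

lemma U_Ken_eq:
  assumes "n \<ge> 2"
  shows "U_Ken n x = 1 / (real n - 1) * (\<Sum>i\<in>{1..n}. \<Sum>j\<in>{1..<i}. 1 / real n * of_bool (x j > x i))"
proof -
  have "(\<Sum>j\<in>{1..n} - {i}. of_bool (j < i) * of_bool (x j > x i))
      = real n * (\<Sum>j\<in>{1..<i}. 1 / real n * of_bool (x j > x i))" if "i \<in> {1..n}" for i
    using sum_mult_of_bool_less[OF that, of "\<lambda>j. of_bool (x j > x i)"] assms
    unfolding sum_distrib_left[symmetric] by simp
  then have "U_Ken n x = 1 / (real n * (real n - 1)) *
      (\<Sum>i\<in>{1..n}. real n * (\<Sum>j\<in>{1..<i}. 1 / real n * of_bool (x j > x i)))"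
    unfolding U_Ken_def by (intro arg_cong2[where f = "(*)"] sum.cong refl) simp
  also have "\<dots> = 1 / (real n - 1) * (\<Sum>i\<in>{1..n}. \<Sum>j\<in>{1..<i}. 1 / real n * of_bool (x j > x i))"
    unfolding sum_distrib_left[symmetric] using assms by simp
  finally show ?thesis .
qed

lemma U_AP_eq:
  assumes "n \<ge> 2"
  shows "U_AP n x = 1 / (real n - 1) * (\<Sum>i\<in>{1..n}. \<Sum>j\<in>{1..<i}. 1 / (real i - 1) * of_bool (x j > x i))"
proof -
  have "(\<Sum>j\<in>{1..n} - {i}. real n * of_bool (j < i) / (real i - 1) * of_bool (x j > x i))
      = real n * (\<Sum>j\<in>{1..<i}. 1 / (real i - 1) * of_bool (x j > x i))" if "i \<in> {1..n}" for i
    using sum_mult_of_bool_less[OF that, of "\<lambda>j. real n / (real i - 1) * of_bool (x j > x i)"]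
    by (simp add: sum_distrib_left mult.commute mult.left_commute)
  then have "U_AP n x = 1 / (real n * (real n - 1)) *
      (\<Sum>i\<in>{1..n}. real n * (\<Sum>j\<in>{1..<i}. 1 / (real i - 1) * of_bool (x j > x i)))"
    unfolding U_AP_def by (intro arg_cong2[where f = "(*)"] sum.cong refl) simp
  also have "\<dots> = 1 / (real n - 1) * (\<Sum>i\<in>{1..n}. \<Sum>j\<in>{1..<i}. 1 / (real i - 1) * of_bool (x j > x i))"
    unfolding sum_distrib_left[symmetric] using assms by simp
  finally show ?thesis .
qed

text \<open>
  The last \<open>d n / 4\<close> indices exceed \<open>3 n / 4\<close>. The gain \<open>d (i - 1) / n\<close> is at least
  \<open>3 d / 4 - d / n\<close>, the loss \<open>(n - i) / n\<close> is at most \<open>d / 4\<close>, and \<open>d / n \<le> d / 4\<close> from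
  \<open>n = 4\<close> on.
\<close>

lemma ken_margin:
  assumes d: "0 < d" "d < 1" and n: "4 \<le> n" and i: "i \<in> {1..n}" and near: "4 * (real n - real i) \<le> d * real n"
  shows "d / 4 \<le> d * (1 / real n * (real i - 1)) - (\<Sum>j\<in>{i<..n}. 1 / real n)"
proof -
  have "d * real n \<le> 1 * real n" using d by (intro mult_right_mono) auto
  then have i3: "3 * real n \<le> 4 * real i" using near by simp
  have "d * real n / 4 \<le> d * (3 * real n / 4 - 1) - d * real n / 4"
  proof -
    have "d * 1 \<le> d * (real n / 4)" using d n by (intro mult_left_mono) auto
    then show ?thesis by (simp add: algebra_simps)
  qed
  also have "\<dots> \<le> d * (real i - 1) - (real n - real i)"
    using i3 near d by (intro diff_mono mult_left_mono) auto
  finally have "d * real n / 4 / real n \<le> (d * (real i - 1) - (real n - real i)) / real n"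
    by (rule divide_right_mono) simp
  then show ?thesis using n i by (simp add: diff_divide_distrib of_nat_diff right_diff_distrib)
qed

lemma sum_inverse_pred_le:
  assumes "1 \<le> i" "i \<le> n"
  shows "(\<Sum>j\<in>{i<..n}. 1 / (real j - 1)) \<le> (real n - real i) / real i"
proof -
  have "(\<Sum>j\<in>{i<..n}. 1 / (real j - 1)) \<le> (\<Sum>j\<in>{i<..n}. 1 / real i)"
    using assms by (intro sum_mono frac_le) auto
  also have "\<dots> = (real n - real i) / real i" using assms by (simp add: of_nat_diff)
  finally show ?thesis .
qed

text \<open>
  The weights of the earlier indices sum to one, so the gain is \<open>d\<close>. The loss is at most
  \<open>(n - i) / i\<close>, a ratio of at most \<open>d n / 4\<close> to at least \<open>3 n / 4\<close>, hence at most \<open>d / 3\<close>.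
\<close>

lemma ap_margin:
  assumes d: "0 < d" "d < 1" and n: "4 \<le> n" and i: "i \<in> {1..n}" and near: "4 * (real n - real i) \<le> d * real n"
  shows "d / 4 \<le> d * (1 / (real i - 1) * (real i - 1)) - (\<Sum>j\<in>{i<..n}. 1 / (real j - 1))"
proof -
  have "d * real n \<le> 1 * real n" using d by (intro mult_right_mono) auto
  then have i3: "3 * real n \<le> 4 * real i" using near by simp
  then have i2: "2 < 4 * real i / 4 " using n by simp
  have "(\<Sum>j\<in>{i<..n}. 1 / (real j - 1)) \<le> (real n - real i) / real i"
    using i by (intro sum_inverse_pred_le) auto
  also have "\<dots> \<le> (d * real n / 4) / (3 * real n / 4)"
    using i3 near n i by (intro frac_le) auto
  also have "\<dots> = d / 3" using n by simp
  finally show ?thesis using i2 d by simp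
qed

text \<open>
  The term \<open>j = 1\<close> is \<open>1 / 0 = 0\<close>.
\<close>

lemma sum_inverse_pred_le_harm: "(\<Sum>j\<in>{1..n}. 1 / (real j - 1)) \<le> harm n"
proof (cases n)
  case (Suc m)
  have "(\<Sum>j\<in>{1..n}. 1 / (real j - 1)) = (\<Sum>j\<in>{0..m}. 1 / real j)"
    unfolding Suc One_nat_def sum.shift_bounds_cl_Suc_ivl by simp
  also have "\<dots> = (\<Sum>j\<in>{1..m}. inverse (real j))"
    by (subst sum.atLeast_Suc_atMost) (auto simp: divide_inverse)
  also have "\<dots> \<le> harm n" unfolding harm_def Suc by (intro sum_mono2) auto
  finally show ?thesis .
qed (simp add: harm_def)

lemma harm_le_one_plus_ln: "n \<ge> 1 \<Longrightarrow> harm n \<le> 1 + ln (real n)"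
  using euler_mascheroni_sequence_decreasing[of 1 n] by (simp add: harm_def)

text \<open>
  The rate \<open>n powr (- 1 / 3)\<close> for \<open>d\<close> makes \<open>n d\<close> grow at least like \<open>n powr (2 / 3)\<close>, which beats
  the square of a logarithm.
\<close>

lemma rate_tendsto_0:
  fixes d :: "nat \<Rightarrow> real"
  assumes d: "\<And>n. n \<ge> 1 \<Longrightarrow> 0 < d n"
    and lower: "(\<lambda>n. real n powr (- 1 / 3)) \<in> O(d)"
    and B: "\<forall>\<^sub>F n in sequentially. \<bar>B n\<bar> \<le> 2 + ln (real n)"
  shows "(\<lambda>n. (B n)\<^sup>2 / (real n * d n)) \<longlonglongrightarrow> 0"
proof -
  obtain C where C: "0 < C" "\<forall>\<^sub>F n in sequentially. norm (real n powr (- 1 / 3)) \<le> C * norm (d n)"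
    using lower by (auto elim: landau_o.bigE)
  have "(\<lambda>n. C * ((2 + ln (real n))\<^sup>2 / (real n * real n powr (- 1 / 3)))) \<longlonglongrightarrow> 0"
    by real_asymp
  then show ?thesis
  proof (rule Lim_null_comparison[rotated])
    show "\<forall>\<^sub>F n in sequentially. norm ((B n)\<^sup>2 / (real n * d n)) \<le> C * ((2 + ln (real n))\<^sup>2 / (real n * real n powr (- 1 / 3)))"
      using C(2) B eventually_ge_at_top[of 1]
    proof eventually_elim
      case (elim n)
      have dn: "0 < d n" using d elim by simp
      have "(B n)\<^sup>2 \<le> (2 + ln (real n))\<^sup>2"
        using power_mono[OF elim(2), of 2] by simp
      moreover have "real n * real n powr (- 1 / 3) \<le> C * (real n * d n)"
        using elim dn by (simp add: mult.left_commute mult_left_mono)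
      ultimately have "(B n)\<^sup>2 * (real n * real n powr (- 1 / 3)) \<le> (2 + ln (real n))\<^sup>2 * (C * (real n * d n))"
        by (rule mult_mono) auto
      then show ?case using elim dn by (simp add: field_simps)
    qed
  qed
qed

theorem theorem3p3:
  fixes M :: "nat \<Rightarrow> 'a measure"
    and X :: "nat \<Rightarrow> nat \<Rightarrow> 'a \<Rightarrow> real"
    and \<delta> p :: "nat \<Rightarrow> real"
  assumes prob: "\<And>n. n \<ge> 1 \<Longrightarrow> prob_space (M n)"
    and indep: "\<And>n. n \<ge> 1 \<Longrightarrow> prob_space.indep_vars (M n) (\<lambda>_. borel) (X n) {1..n}"
    and abs_cont: "\<And>n i. n \<ge> 1 \<Longrightarrow> i \<in> {1..n} \<Longrightarrow>
          absolutely_continuous lborel (distr (M n) borel (X n i))"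
    and delta: "\<And>n. n \<ge> 1 \<Longrightarrow> \<delta> n \<in> {0<..<1}"
    and p: "\<And>n. n \<ge> 1 \<Longrightarrow> p n \<in> {0<..<1}"
    and cond: "\<forall>\<^sub>F n in sequentially. \<forall>i\<in>{1..n}.
          measure (M n) {\<omega> \<in> space (M n). \<forall>j\<in>{1..n} - {i}.
              excess (M n) (X n) i j \<omega> \<in> {\<delta> n..1}} \<ge> p n
        \<or> measure (M n) {\<omega> \<in> space (M n). \<forall>j\<in>{1..n} - {i}.
              excess (M n) (X n) i j \<omega> \<in> {-1..- \<delta> n}} \<ge> p n"
  shows "(gnsim (\<lambda>n. \<delta> n ^ 3 * p n) (\<lambda>n. real n powr (- 1 / 3)) \<longrightarrow>
           weak_conv_m
             (\<lambda>n. distr (M n) borel (standardized (M n) (\<lambda>\<omega>. U_Ken n (\<lambda>i. X n i \<omega>))))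
             std_normal_distribution)
       \<and> (gnsim (\<lambda>n. \<delta> n ^ 3 * p n) (\<lambda>n. real n powr (- 1 / 3) * (ln (real n))\<^sup>2) \<longrightarrow>
           weak_conv_m
             (\<lambda>n. distr (M n) borel (standardized (M n) (\<lambda>\<omega>. U_AP n (\<lambda>i. X n i \<omega>))))
             std_normal_distribution)"
proof (intro conjI impI)
  have d0: "0 < \<delta> n ^ 3 * p n" if "n \<ge> 1" for n
    using delta[OF that] p[OF that] by simp
  note clt = weak_conv_weighted_discordance[OF prob indep abs_cont delta p cond]
  have large: "\<forall>\<^sub>F n in sequentially. (4::nat) \<le> n" by (rule eventually_ge_at_top)
  {
    assume "gnsim (\<lambda>n. \<delta> n ^ 3 * p n) (\<lambda>n. real n powr (- 1 / 3))"
    then have lower: "(\<lambda>n. real n powr (- 1 / 3)) \<in> O(\<lambda>n. \<delta> n ^ 3 * p n)"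
      by (simp add: gnsim_def)
    show "weak_conv_m (\<lambda>n. distr (M n) borel (standardized (M n) (\<lambda>\<omega>. U_Ken n (\<lambda>i. X n i \<omega>)))) std_normal_distribution"
    proof (rule clt[where v = "\<lambda>n i. 1 / real n" and c = "\<lambda>n. 1 / (real n - 1)" and B = "\<lambda>_. 1"])
      show "\<forall>\<^sub>F n in sequentially. 0 < 1 / (real n - 1) \<and>
          (\<forall>x. U_Ken n x = 1 / (real n - 1) * (\<Sum>i\<in>{1..n}. \<Sum>j\<in>{1..<i}. 1 / real n * of_bool (x j > x i)))"
        using large by eventually_elim (auto simp only: U_Ken_eq, simp)
      show "\<forall>\<^sub>F n in sequentially. \<forall>i\<in>{1..n}. 1 / real n * (real i - 1) + (\<Sum>j\<in>{i<..n}. 1 / real n) \<le> 1"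
        using large
      proof eventually_elim
        case (elim n)
        then show ?case by (auto simp: of_nat_diff divide_le_eq add_divide_distrib[symmetric])
      qed
      show "\<forall>\<^sub>F n in sequentially. (\<Sum>i\<in>{1..n}. (real i - 1) * (1 / real n)\<^sup>2) \<le> 1\<^sup>2"
        using large
      proof eventually_elim
        case (elim n)
        have "(\<Sum>i\<in>{1..n}. (real i - 1) * (1 / real n)\<^sup>2) \<le> (\<Sum>i\<in>{1..n}. real n * (1 / real n)\<^sup>2)"
          by (intro sum_mono mult_right_mono) auto
        also have "\<dots> = 1" using elim by (simp add: power2_eq_square)
        finally show ?case by simp
      qed
      show "\<forall>\<^sub>F n in sequentially. \<forall>i\<in>{1..n}. 4 * (real n - real i) \<le> \<delta> n * real n \<longrightarrow>
          \<delta> n / 4 \<le> \<delta> n * (1 / real n * (real i - 1)) - (\<Sum>j\<in>{i<..n}. 1 / real n)"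
        using large
      proof eventually_elim
        case (elim n)
        then show ?case using ken_margin[of "\<delta> n" n] delta[of n] by auto
      qed
      show "(\<lambda>n. 1\<^sup>2 / (real n * (\<delta> n ^ 3 * p n))) \<longlonglongrightarrow> 0"
      proof (rule rate_tendsto_0[OF d0 lower])
        show "\<forall>\<^sub>F n in sequentially. \<bar>1\<bar> \<le> 2 + ln (real n)"
          using large by eventually_elim simp
      qed
    qed simp_all
  }
  assume "gnsim (\<lambda>n. \<delta> n ^ 3 * p n) (\<lambda>n. real n powr (- 1 / 3) * (ln (real n))\<^sup>2)"
  then have "(\<lambda>n. real n powr (- 1 / 3) * (ln (real n))\<^sup>2) \<in> O(\<lambda>n. \<delta> n ^ 3 * p n)"
    by (simp add: gnsim_def)
  moreover have "(\<lambda>n. real n powr (- 1 / 3)) \<in> O(\<lambda>n. real n powr (- 1 / 3) * (ln (real n))\<^sup>2)"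
    by real_asymp
  ultimately have lower: "(\<lambda>n. real n powr (- 1 / 3)) \<in> O(\<lambda>n. \<delta> n ^ 3 * p n)"
    by (rule landau_o.big_trans[rotated])
  show "weak_conv_m (\<lambda>n. distr (M n) borel (standardized (M n) (\<lambda>\<omega>. U_AP n (\<lambda>i. X n i \<omega>)))) std_normal_distribution"
  proof (rule clt[where v = "\<lambda>n i. 1 / (real i - 1)" and c = "\<lambda>n. 1 / (real n - 1)" and B = "\<lambda>n. 1 + harm n"])
    show "\<forall>\<^sub>F n in sequentially. 0 < 1 / (real n - 1) \<and>
        (\<forall>x. U_AP n x = 1 / (real n - 1) * (\<Sum>i\<in>{1..n}. \<Sum>j\<in>{1..<i}. 1 / (real i - 1) * of_bool (x j > x i)))"
      using large by eventually_elim (auto simp only: U_AP_eq, simp)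
    show "0 \<le> 1 / (real i - 1)" if "1 \<le> i" for i :: nat
      using that by simp
    show "\<forall>\<^sub>F n in sequentially. \<forall>i\<in>{1..n}.
        1 / (real i - 1) * (real i - 1) + (\<Sum>j\<in>{i<..n}. 1 / (real j - 1)) \<le> 1 + harm n"
    proof (intro always_eventually allI ballI add_mono)
      fix n i :: nat assume "i \<in> {1..n}"
      then have "(\<Sum>j\<in>{i<..n}. 1 / (real j - 1)) \<le> (\<Sum>j\<in>{1..n}. 1 / (real j - 1))"
        by (intro sum_mono2) auto
      also note sum_inverse_pred_le_harm
      finally show "(\<Sum>j\<in>{i<..n}. 1 / (real j - 1)) \<le> harm n" .
    qed simp
    show "\<forall>\<^sub>F n in sequentially. (\<Sum>i\<in>{1..n}. (real i - 1) * (1 / (real i - 1))\<^sup>2) \<le> (1 + harm n)\<^sup>2"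
    proof (intro always_eventually allI)
      fix n
      have "(\<Sum>i\<in>{1..n}. (real i - 1) * (1 / (real i - 1))\<^sup>2) = (\<Sum>i\<in>{1..n}. 1 / (real i - 1))"
        by (intro sum.cong) (auto simp: power2_eq_square)
      also note sum_inverse_pred_le_harm
      also have "harm n \<le> (1 + harm n :: real)\<^sup>2"
        using harm_nonneg[of n, where 'a = real] by (simp add: power2_eq_square algebra_simps)
      finally show "(\<Sum>i\<in>{1..n}. (real i - 1) * (1 / (real i - 1))\<^sup>2) \<le> (1 + harm n)\<^sup>2" .
    qed
    show "\<forall>\<^sub>F n in sequentially. \<forall>i\<in>{1..n}. 4 * (real n - real i) \<le> \<delta> n * real n \<longrightarrow>
        \<delta> n / 4 \<le> \<delta> n * (1 / (real i - 1) * (real i - 1)) - (\<Sum>j\<in>{i<..n}. 1 / (real j - 1))"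
      using large
    proof eventually_elim
      case (elim n)
      then show ?case using ap_margin[of "\<delta> n" n] delta[of n] by auto
    qed
    show "(\<lambda>n. (1 + harm n)\<^sup>2 / (real n * (\<delta> n ^ 3 * p n))) \<longlonglongrightarrow> 0"
    proof (rule rate_tendsto_0[OF d0 lower])
      show "\<forall>\<^sub>F n in sequentially. \<bar>1 + harm n\<bar> \<le> 2 + ln (real n)"
        using eventually_ge_at_top[of 1]
      proof eventually_elim
        case (elim n)
        then show ?case using harm_le_one_plus_ln[of n] harm_nonneg[of n, where 'a = real] by simp
      qed
    qed
  qed
qed

end
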